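(* Let $p\colon E\to B$ be a locally trivial bundle with fiber $F$ and structure group $G$, which coincides with the associated bundle of a principal $G$-bundle $q\colon P\to B$, so that $E=F\times_G P$ and $B=P/G$. Then for each $r\ge 2$, $$\mathrm{dTC}_{r}[p\colon F\times_G P\to P/G]\leq (\mathrm{dTC}_{G,r}(F)+1)^2-1.$$
   Context: For a topological group $G$, a $G$-space $F$ and a principal $G$-bundle $q\colon P\to B$, $F\times_G P:=(F\times P)/G$ is the orbit space of the diagonal action, and $p\colon F\times_G P\to P/G$ is the associated locally trivial bundle with fiber $F$ and structure group $G$ (the $F$-associate of $q$). Conventions: all spaces are path-connected, fibrations are Hurewicz fibrations, sections are continuous, $I=[0,1]$, path spaces carry the compact-open topology; total spaces to which the distributional invariants are applied are metric spaces. For a metric space $X$ and $k\ge 1$, $\mathcal{B}_k(X)$ is the set of probability measures on $X$ supported on at most $k$ points, with the Lévy–Prokhorov metric topology. For a fibration $p\colon E\to B$ with $E$ metric, let $E_k(p)=\{\mu\in\mathcal{B}_k(E)\mid \mathrm{supp}(\mu)\subset p^{-1}(x)\text{ for some }x\in B\}$ and $\mathcal{B}_k(p)\colon E_k(p)\to B$, $\mathcal{B}_k(p)(\mu)=x$ if $\mathrm{supp}(\mu)\subset p^{-1}(x)$. $\mathrm{dsecat}(p)$ is the smallest integer $n\geq 0$ such that $\mathcal{B}_{n+1}(p)$ admits a section. If $p$ is a $G$-fibration (a $G$-map with the homotopy lifting property for $G$-equivariant homotopies), $G$ acts on $E_k(p)$ by $g\cdot\sum\lambda_e e=\sum\lambda_e\,(ge)$,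 and $\mathrm{dsecat}_G(p)$ is the smallest integer $n\ge0$ such that $\mathcal{B}_{n+1}(p)$ admits a $G$-equivariant section. For a fibration $p\colon E\to B$ and $r\ge2$: $E^I_B=\{\gamma\in E^I\mid p\circ\gamma \text{ is constant}\}$, $E^r_B=\{(e_1,\dots,e_r)\in E^r\mid p(e_i)=p(e_j)\ \forall i,j\}$, and $\Pi_r^E\colon E^I_B\to E^r_B$ is the fibration $\gamma\mapsto(\gamma(0),\gamma(\tfrac1{r-1}),\dots,\gamma(\tfrac{r-2}{r-1}),\gamma(1))$. Define $\mathrm{dTC}_r[p\colon E\to B]:=\mathrm{dsecat}(\Pi_r^E)$. For a $G$-space $X$: $\pi_r^X\colon X^I\to X^r$, $\phi\mapsto(\phi(0),\phi(\tfrac1{r-1}),\dots,\phi(1))$, is a $G$-fibration, where $(g\phi)(t)=g\cdot\phi(t)$ and $X^r$ has the diagonal action; $\mathrm{dTC}_{G,r}(X):=\mathrm{dsecat}_G(\pi_r^X)$. *)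

theory Defs
  imports "HOL-Probability.Probability_Mass_Function" "HOL-Library.Extended_Nat"
    "HOL-Algebra.Group_Action"
begin

section \<open>Topological groups, actions, orbit spaces\<close>

definition topological_group :: "('g, 'z) monoid_scheme \<Rightarrow> 'g topology \<Rightarrow> bool"
  where "topological_group G TG \<longleftrightarrow>
    group G \<and> topspace TG = carrier G \<and>
    continuous_map (prod_topology TG TG) TG (\<lambda>(x, y). x \<otimes>\<^bsub>G\<^esub> y) \<and>
    continuous_map TG TG (\<lambda>x. inv\<^bsub>G\<^esub> x)"

definition G_space :: "('g, 'z) monoid_scheme \<Rightarrow> 'g topology \<Rightarrow> 'x topology \<Rightarrow> ('g \<Rightarrow> 'x \<Rightarrow> 'x) \<Rightarrow> bool"
  where "G_space G TG X \<phi> \<longleftrightarrow>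
    topological_group G TG \<and> group_action G (topspace X) \<phi> \<and>
    continuous_map (prod_topology TG X) X (\<lambda>(g, x). \<phi> g x)"

definition diagonal_action :: "('g \<Rightarrow> 'x \<Rightarrow> 'x) \<Rightarrow> ('g \<Rightarrow> 'y \<Rightarrow> 'y) \<Rightarrow> 'g \<Rightarrow> 'x \<times> 'y \<Rightarrow> 'x \<times> 'y"
  where "diagonal_action \<phi> \<psi> g = (\<lambda>(x, y). (\<phi> g x, \<psi> g y))"

text \<open>The quotient topology on the set of orbits; see \<open>quotient_map_orbit\<close> below.\<close>

definition orbit_space :: "('g, 'z) monoid_scheme \<Rightarrow> 'x topology \<Rightarrow> ('g \<Rightarrow> 'x \<Rightarrow> 'x) \<Rightarrow> 'x set topology"
  where "orbit_space G X \<phi> = topology (\<lambda>V. V \<subseteq> orbits G (topspace X) \<phi> \<and>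
    openin X {x \<in> topspace X. orbit G \<phi> x \<in> V})"

lemma openin_orbit_space:
  "openin (orbit_space G X \<phi>) V \<longleftrightarrow>
    V \<subseteq> orbits G (topspace X) \<phi> \<and> openin X {x \<in> topspace X. orbit G \<phi> x \<in> V}"
proof -
  have "istopology (\<lambda>V. V \<subseteq> orbits G (topspace X) \<phi> \<and>
    openin X {x \<in> topspace X. orbit G \<phi> x \<in> V})" (is "istopology ?op")
    unfolding istopology_def
  proof (intro conjI allI impI)
    fix S T assume *: "?op S" "?op T"
    have "{x \<in> topspace X. orbit G \<phi> x \<in> S \<inter> T} =
      {x \<in> topspace X. orbit G \<phi> x \<in> S} \<inter> {x \<in> topspace X. orbit G \<phi> x \<in> T}" by blast
    then show "S \<inter> T \<subseteq> orbits G (topspace X) \<phi>"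
      "openin X {x \<in> topspace X. orbit G \<phi> x \<in> S \<inter> T}"
      using * by auto
  next
    fix K assume *: "\<forall>S\<in>K. ?op S"
    have "{x \<in> topspace X. orbit G \<phi> x \<in> \<Union>K} =
      (\<Union>S\<in>K. {x \<in> topspace X. orbit G \<phi> x \<in> S})" by blast
    then show "\<Union>K \<subseteq> orbits G (topspace X) \<phi>"
      "openin X {x \<in> topspace X. orbit G \<phi> x \<in> \<Union>K}"
      using * by auto
  qed
  then show ?thesis
    by (simp add: orbit_space_def topology_inverse')
qed

lemma topspace_orbit_space: "topspace (orbit_space G X \<phi>) = orbits G (topspace X) \<phi>"
proof -
  have "{x \<in> topspace X. orbit G \<phi> x \<in> orbits G (topspace X) \<phi>} = topspace X"
    by (auto simp: orbits_def)
  then have "openin (orbit_space G X \<phi>) (orbits G (topspace X) \<phi>)"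
    by (simp add: openin_orbit_space)
  then show ?thesis
    by (meson openin_orbit_space openin_subset openin_topspace subset_antisym)
qed

lemma quotient_map_orbit: "quotient_map X (orbit_space G X \<phi>) (orbit G \<phi>)"
  unfolding quotient_map_def topspace_orbit_space openin_orbit_space
  by (auto simp: orbits_def)

text \<open>Actions are on the left, so a local trivialization is equivariant for left translation
  on the group factor.\<close>

definition principal_bundle ::
    "('g, 'z) monoid_scheme \<Rightarrow> 'g topology \<Rightarrow> 'p topology \<Rightarrow> ('g \<Rightarrow> 'p \<Rightarrow> 'p) \<Rightarrow> 'b topology \<Rightarrow> ('p \<Rightarrow> 'b) \<Rightarrow> bool"
  where "principal_bundle G TG P \<psi> B q \<longleftrightarrow>
    G_space G TG P \<psi> \<and> continuous_map P B q \<and>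
    (\<forall>b\<in>topspace B. \<exists>U h. openin B U \<and> b \<in> U \<and>
      homeomorphic_map (prod_topology (subtopology B U) TG)
        (subtopology P {x \<in> topspace P. q x \<in> U}) h \<and>
      (\<forall>u\<in>U. \<forall>k\<in>carrier G. q (h (u, k)) = u) \<and>
      (\<forall>u\<in>U. \<forall>k\<in>carrier G. \<forall>g\<in>carrier G. h (u, g \<otimes>\<^bsub>G\<^esub> k) = \<psi> g (h (u, k))))"

definition assoc_space ::
    "('g, 'z) monoid_scheme \<Rightarrow> 'f topology \<Rightarrow> ('g \<Rightarrow> 'f \<Rightarrow> 'f) \<Rightarrow> 'p topology \<Rightarrow> ('g \<Rightarrow> 'p \<Rightarrow> 'p) \<Rightarrow> ('f \<times> 'p) set topology"
  where "assoc_space G F \<phi> P \<psi> = orbit_space G (prod_topology F P) (diagonal_action \<phi> \<psi>)"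

text \<open>The map \<open>[f, x] \<mapsto> [x]\<close>: the second components of the pairs in the orbit of \<open>(f, x)\<close>
  form the orbit of \<open>x\<close>.\<close>

definition assoc_proj :: "('f \<times> 'p) set \<Rightarrow> 'p set"
  where "assoc_proj c = snd ` c"

lemma assoc_proj_orbit: "assoc_proj (orbit G (diagonal_action \<phi> \<psi>) (f, x)) = orbit G \<psi> x"
  by (auto simp: assoc_proj_def orbit_def diagonal_action_def image_iff)

section \<open>Path spaces\<close>

text \<open>Paths are represented by functions on the reals with the fixed value \<open>undefined\<close> outside
  the unit interval, so that distinct functions are distinct paths.\<close>

definition paths :: "'x topology \<Rightarrow> (real \<Rightarrow> 'x) set"
  where "paths X = {\<gamma> \<in> extensional {0..1}. pathin X \<gamma>}"

text \<open>The compact-open topology.\<close>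

definition path_space :: "'x topology \<Rightarrow> (real \<Rightarrow> 'x) topology"
  where "path_space X = topology_generated_by
    {{\<gamma> \<in> paths X. \<gamma> ` K \<subseteq> U} | K U. compact K \<and> K \<subseteq> {0..1} \<and> openin X U}"

lemma topspace_path_space: "topspace (path_space X) = paths X"
proof -
  have "paths X \<in> {{\<gamma> \<in> paths X. \<gamma> ` K \<subseteq> U} | K U. compact K \<and> K \<subseteq> {0..1} \<and> openin X U}"
    by (intro CollectI exI[of _ "{}"]) auto
  then show ?thesis
    by (auto simp: path_space_def topology_generated_by_topspace)
qed

text \<open>The spaces \<open>E\<^sup>I\<^sub>B\<close> and \<open>E\<^sup>r\<^sub>B\<close>, and the evaluation of a path at
  \<open>0, 1/(r-1), \<dots>, 1\<close>. Tuples are indexed by \<open>{..<r}\<close>.\<close>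

definition vertical_path_space :: "'e topology \<Rightarrow> ('e \<Rightarrow> 'b) \<Rightarrow> (real \<Rightarrow> 'e) topology"
  where "vertical_path_space E p =
    subtopology (path_space E) {\<gamma>. \<exists>b. \<forall>t\<in>{0..1}. p (\<gamma> t) = b}"

definition power_space :: "nat \<Rightarrow> 'x topology \<Rightarrow> (nat \<Rightarrow> 'x) topology"
  where "power_space r X = product_topology (\<lambda>_. X) {..<r}"

definition fibre_power :: "nat \<Rightarrow> 'e topology \<Rightarrow> ('e \<Rightarrow> 'b) \<Rightarrow> (nat \<Rightarrow> 'e) topology"
  where "fibre_power r E p =
    subtopology (power_space r E) {e. \<forall>i<r. \<forall>j<r. p (e i) = p (e j)}"

definition path_eval :: "nat \<Rightarrow> (real \<Rightarrow> 'x) \<Rightarrow> nat \<Rightarrow> 'x"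
  where "path_eval r \<gamma> = (\<lambda>i\<in>{..<r}. \<gamma> (real i / real (r - 1)))"

definition path_action :: "('g \<Rightarrow> 'x \<Rightarrow> 'x) \<Rightarrow> 'g \<Rightarrow> (real \<Rightarrow> 'x) \<Rightarrow> real \<Rightarrow> 'x"
  where "path_action \<phi> g \<gamma> = (\<lambda>t\<in>{0..1}. \<phi> g (\<gamma> t))"

definition power_action :: "nat \<Rightarrow> ('g \<Rightarrow> 'x \<Rightarrow> 'x) \<Rightarrow> 'g \<Rightarrow> (nat \<Rightarrow> 'x) \<Rightarrow> nat \<Rightarrow> 'x"
  where "power_action r \<phi> g x = (\<lambda>i\<in>{..<r}. \<phi> g (x i))"

section \<open>Finitely supported measures and the Levy-Prokhorov metric\<close>

text \<open>A probability measure supported on at most \<open>k\<close> points is a convex combination of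
  Dirac measures, hence the same thing as a probability mass function with at most \<open>k\<close>
  points in its support.\<close>

definition fin_measures :: "'x metric \<Rightarrow> nat \<Rightarrow> 'x pmf set"
  where "fin_measures M k =
    {\<mu>. set_pmf \<mu> \<subseteq> mspace M \<and> finite (set_pmf \<mu>) \<and> card (set_pmf \<mu>) \<le> k}"

definition nbhd :: "'x metric \<Rightarrow> real \<Rightarrow> 'x set \<Rightarrow> 'x set"
  where "nbhd M \<epsilon> A = {x \<in> mspace M. \<exists>a\<in>A. mdist M a x < \<epsilon>}"

definition borel_sets :: "'x metric \<Rightarrow> 'x set set"
  where "borel_sets M = sigma_sets (mspace M) {U. openin (mtopology_of M) U}"

definition LP_close :: "'x metric \<Rightarrow> 'x pmf \<Rightarrow> 'x pmf \<Rightarrow> real \<Rightarrow> bool"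
  where "LP_close M \<mu> \<nu> \<epsilon> \<longleftrightarrow> \<epsilon> > 0 \<and> (\<forall>A\<in>borel_sets M.
    measure_pmf.prob \<mu> A \<le> measure_pmf.prob \<nu> (nbhd M \<epsilon> A) + \<epsilon> \<and>
    measure_pmf.prob \<nu> A \<le> measure_pmf.prob \<mu> (nbhd M \<epsilon> A) + \<epsilon>)"

definition LP_dist :: "'x metric \<Rightarrow> 'x pmf \<Rightarrow> 'x pmf \<Rightarrow> real"
  where "LP_dist M \<mu> \<nu> = Inf {\<epsilon>. LP_close M \<mu> \<nu> \<epsilon>}"

definition fin_measure_space :: "'x metric \<Rightarrow> nat \<Rightarrow> 'x pmf topology"
  where "fin_measure_space M k = Metric_space.mtopology (fin_measures M k) (LP_dist M)"

lemma LP_close_1: "LP_close M \<mu> \<nu> 1"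
proof -
  have "measure_pmf.prob \<mu> A \<le> measure_pmf.prob \<nu> C + 1" for \<mu> \<nu> :: "'a pmf" and A C
    by (meson add_increasing measure_nonneg measure_pmf.prob_le_1)
  then show ?thesis by (simp add: LP_close_def)
qed

lemma LP_bdd: "bdd_below {\<epsilon>. LP_close M \<mu> \<nu> \<epsilon>}"
  by (rule bdd_belowI[of _ 0]) (auto simp: LP_close_def)

lemma LP_dist_nonneg: "0 \<le> LP_dist M \<mu> \<nu>"
proof -
  have "{\<epsilon>. LP_close M \<mu> \<nu> \<epsilon>} \<noteq> {}" using LP_close_1 by blast
  then show ?thesis
    unfolding LP_dist_def by (rule cInf_greatest) (simp add: LP_close_def)
qed

lemma LP_dist_le: "LP_close M \<mu> \<nu> \<epsilon> \<Longrightarrow> LP_dist M \<mu> \<nu> \<le> \<epsilon>"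
  unfolding LP_dist_def by (rule cInf_lower) (auto intro: LP_bdd)

lemma LP_dist_lessE:
  assumes "LP_dist M \<mu> \<nu> < \<epsilon>"
  obtains \<delta> where "LP_close M \<mu> \<nu> \<delta>" "\<delta> < \<epsilon>"
  using assms cInf_lessD[of "{\<epsilon>. LP_close M \<mu> \<nu> \<epsilon>}" \<epsilon>] LP_close_1[of M \<mu> \<nu>]
  unfolding LP_dist_def by auto

lemma nbhd_open: "A \<subseteq> mspace M \<Longrightarrow> openin (mtopology_of M) (nbhd M \<epsilon> A)"
proof -
  interpret Metric_space "mspace M" "mdist M" by simp
  assume A: "A \<subseteq> mspace M"
  have "nbhd M \<epsilon> A = (\<Union>a\<in>A. mball a \<epsilon>)"
    using A by (fastforce simp: nbhd_def)
  then show ?thesis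
    by (auto simp: mtopology_of_def)
qed

lemma borel_sets_subset: "A \<in> borel_sets M \<Longrightarrow> A \<subseteq> mspace M"
  unfolding borel_sets_def
  by (erule sigma_sets_into_sp[rotated]) (use openin_subset in fastforce)

lemma nbhd_borel: "A \<in> borel_sets M \<Longrightarrow> nbhd M \<epsilon> A \<in> borel_sets M"
  using nbhd_open[OF borel_sets_subset] unfolding borel_sets_def by auto

lemma LP_close_trans:
  assumes "LP_close M \<mu> \<nu> \<epsilon>" "LP_close M \<nu> \<rho> \<delta>"
  shows "LP_close M \<mu> \<rho> (\<epsilon> + \<delta>)"
proof -
  have pos: "\<epsilon> > 0" "\<delta> > 0" using assms by (auto simp: LP_close_def)
  have sub: "nbhd M s (nbhd M t A) \<subseteq> nbhd M (t + s) A" if "A \<in> borel_sets M" for A s t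
  proof
    fix x assume "x \<in> nbhd M s (nbhd M t A)"
    then obtain y a where *: "x \<in> mspace M" "y \<in> mspace M" "a \<in> A" "mdist M y x < s" "mdist M a y < t"
      by (auto simp: nbhd_def)
    moreover have "a \<in> mspace M" using borel_sets_subset that * by blast
    ultimately have "mdist M a x < t + s" using mdist_triangle[of a M y x] by simp
    then show "x \<in> nbhd M (t + s) A" using * by (auto simp: nbhd_def)
  qed
  have "measure_pmf.prob \<mu> A \<le> measure_pmf.prob \<rho> (nbhd M (\<epsilon> + \<delta>) A) + (\<epsilon> + \<delta>) \<and>
    measure_pmf.prob \<rho> A \<le> measure_pmf.prob \<mu> (nbhd M (\<epsilon> + \<delta>) A) + (\<epsilon> + \<delta>)"
    if A: "A \<in> borel_sets M" for A
  proof -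
    have "measure_pmf.prob \<mu> A \<le> measure_pmf.prob \<nu> (nbhd M \<epsilon> A) + \<epsilon>"
      using assms(1) A by (auto simp: LP_close_def)
    moreover have "measure_pmf.prob \<nu> (nbhd M \<epsilon> A) \<le> measure_pmf.prob \<rho> (nbhd M \<delta> (nbhd M \<epsilon> A)) + \<delta>"
      using assms(2) nbhd_borel[OF A] by (auto simp: LP_close_def)
    moreover have "measure_pmf.prob \<rho> (nbhd M \<delta> (nbhd M \<epsilon> A)) \<le> measure_pmf.prob \<rho> (nbhd M (\<epsilon> + \<delta>) A)"
      using sub[OF A] by (intro measure_pmf.finite_measure_mono) auto
    moreover have "measure_pmf.prob \<rho> A \<le> measure_pmf.prob \<nu> (nbhd M \<delta> A) + \<delta>"
      using assms(2) A by (auto simp: LP_close_def)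
    moreover have "measure_pmf.prob \<nu> (nbhd M \<delta> A) \<le> measure_pmf.prob \<mu> (nbhd M \<epsilon> (nbhd M \<delta> A)) + \<epsilon>"
      using assms(1) nbhd_borel[OF A] by (auto simp: LP_close_def)
    moreover have "measure_pmf.prob \<mu> (nbhd M \<epsilon> (nbhd M \<delta> A)) \<le> measure_pmf.prob \<mu> (nbhd M (\<epsilon> + \<delta>) A)"
      using sub[OF A, of \<epsilon> \<delta>] by (intro measure_pmf.finite_measure_mono) (auto simp: add.commute)
    ultimately show ?thesis by linarith
  qed
  then show ?thesis using pos by (simp add: LP_close_def)
qed

lemma singleton_borel: "x \<in> mspace M \<Longrightarrow> {x} \<in> borel_sets M"
proof -
  interpret Metric_space "mspace M" "mdist M" by simp
  assume x: "x \<in> mspace M"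
  then have "closedin (mtopology_of M) {x}"
    by (simp add: mtopology_of_def closedin_t1_singleton t1_space_mtopology)
  then have "mspace M - {x} \<in> borel_sets M"
    by (auto simp: borel_sets_def closedin_def)
  then have "mspace M - (mspace M - {x}) \<in> borel_sets M"
    unfolding borel_sets_def by (rule sigma_sets.Compl)
  moreover have "mspace M - (mspace M - {x}) = {x}" using x by auto
  ultimately show ?thesis by simp
qed

lemma LP_dist_0_pmf_le:
  assumes "LP_dist M \<mu> \<nu> = 0" and \<nu>: "set_pmf \<nu> \<subseteq> mspace M" "finite (set_pmf \<nu>)" and x: "x \<in> mspace M"
  shows "pmf \<mu> x \<le> pmf \<nu> x"
proof (rule field_le_epsilon)
  fix e :: real assume e: "e > 0"
  define D where "D = insert e (mdist M x ` (set_pmf \<nu> - {x}))"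
  have fin: "finite D" "D \<noteq> {}" using \<nu> by (auto simp: D_def)
  have "\<forall>d\<in>D. d > 0"
    using e \<nu>(1) x by (auto simp: D_def order.strict_iff_order subset_iff)
  then have "Min D > 0" using fin by simp
  then obtain \<delta> where \<delta>: "LP_close M \<mu> \<nu> \<delta>" "\<delta> < Min D"
    using LP_dist_lessE assms(1) by metis
  have *: "nbhd M \<delta> {x} \<inter> set_pmf \<nu> \<subseteq> {x}"
  proof clarify
    fix y assume y: "y \<in> nbhd M \<delta> {x}" "y \<in> set_pmf \<nu>"
    show "y = x"
    proof (rule ccontr)
      assume "y \<noteq> x"
      then have "Min D \<le> mdist M x y" using y fin by (intro Min_le) (auto simp: D_def)
      then show False using y(1) \<delta>(2) by (auto simp: nbhd_def)
    qed
  qed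
  have "pmf \<mu> x = measure_pmf.prob \<mu> {x}" by (simp add: measure_pmf_single)
  also have "\<dots> \<le> measure_pmf.prob \<nu> (nbhd M \<delta> {x}) + \<delta>"
    using \<delta>(1) singleton_borel[OF x] by (auto simp: LP_close_def)
  also have "measure_pmf.prob \<nu> (nbhd M \<delta> {x}) = measure_pmf.prob \<nu> (nbhd M \<delta> {x} \<inter> set_pmf \<nu>)"
    by (simp add: measure_Int_set_pmf)
  also have "\<dots> \<le> measure_pmf.prob \<nu> {x}"
    using * by (intro measure_pmf.finite_measure_mono) auto
  also have "\<dots> = pmf \<nu> x" by (simp add: measure_pmf_single)
  also have "\<delta> \<le> e" using \<delta>(2) fin by (auto simp: D_def)
  finally show "pmf \<mu> x \<le> pmf \<nu> x + e" by simp
qed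

lemma LP_dist_commute: "LP_dist M \<mu> \<nu> = LP_dist M \<nu> \<mu>"
  by (simp add: LP_dist_def LP_close_def conj_commute)

lemma LP_dist_self: "LP_dist M \<mu> \<mu> = 0" if "set_pmf \<mu> \<subseteq> mspace M"
proof (rule antisym)
  show "LP_dist M \<mu> \<mu> \<le> 0"
  proof (rule field_le_epsilon)
    fix e :: real assume e: "e > 0"
    have "A \<subseteq> nbhd M e A" if "A \<in> borel_sets M" for A
      using borel_sets_subset[OF that] e
      by (auto simp: nbhd_def intro!: bexI) (metis mdist_zero subsetD)
    then have "measure_pmf.prob \<mu> A \<le> measure_pmf.prob \<mu> (nbhd M e A) + e"
      if "A \<in> borel_sets M" for A
      using measure_pmf.finite_measure_mono[of A "nbhd M e A" \<mu>] that e by fastforce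
    then have "LP_close M \<mu> \<mu> e" using e by (simp add: LP_close_def)
    then show "LP_dist M \<mu> \<mu> \<le> 0 + e" using LP_dist_le by simp
  qed
next
  show "0 \<le> LP_dist M \<mu> \<mu>"
    by (rule LP_dist_nonneg)
qed

lemma Metric_space_LP_dist: "Metric_space (fin_measures M k) (LP_dist M)"
proof
  fix \<mu> \<nu> :: "'a pmf"
  show "0 \<le> LP_dist M \<mu> \<nu>"
    by (rule LP_dist_nonneg)
  show "LP_dist M \<mu> \<nu> = LP_dist M \<nu> \<mu>" by (rule LP_dist_commute)
next
  fix \<mu> \<nu> assume *: "\<mu> \<in> fin_measures M k" "\<nu> \<in> fin_measures M k"
  show "LP_dist M \<mu> \<nu> = 0 \<longleftrightarrow> \<mu> = \<nu>"
  proof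
    assume 0: "LP_dist M \<mu> \<nu> = 0"
    show "\<mu> = \<nu>"
    proof (rule pmf_eqI)
      fix x
      show "pmf \<mu> x = pmf \<nu> x"
      proof (cases "x \<in> mspace M")
        case True
        then show ?thesis
          using LP_dist_0_pmf_le[OF 0 _ _ True] LP_dist_0_pmf_le[of M \<nu> \<mu> x] 0 *
          by (auto simp: fin_measures_def LP_dist_commute intro!: antisym)
      next
        case False
        then have "x \<notin> set_pmf \<mu>" "x \<notin> set_pmf \<nu>" using * by (auto simp: fin_measures_def)
        then show ?thesis by (simp add: set_pmf_iff)
      qed
    qed
  qed (use * LP_dist_self in \<open>auto simp: fin_measures_def\<close>)
next
  fix \<mu> \<nu> \<rho> assume "\<mu> \<in> fin_measures M k" "\<nu> \<in> fin_measures M k" "\<rho> \<in> fin_measures M k"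
  show "LP_dist M \<mu> \<rho> \<le> LP_dist M \<mu> \<nu> + LP_dist M \<nu> \<rho>"
  proof (rule field_le_epsilon)
    fix e :: real assume e: "e > 0"
    obtain a where a: "LP_close M \<mu> \<nu> a" "a < LP_dist M \<mu> \<nu> + e / 2"
      using LP_dist_lessE[of M \<mu> \<nu> "LP_dist M \<mu> \<nu> + e / 2"] e by auto
    obtain b where b: "LP_close M \<nu> \<rho> b" "b < LP_dist M \<nu> \<rho> + e / 2"
      using LP_dist_lessE[of M \<nu> \<rho> "LP_dist M \<nu> \<rho> + e / 2"] e by auto
    show "LP_dist M \<mu> \<rho> \<le> LP_dist M \<mu> \<nu> + LP_dist M \<nu> \<rho> + e"
      using LP_dist_le[OF LP_close_trans[OF a(1) b(1)]] a b by simp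
  qed
qed

section \<open>Distributional sectional category and topological complexity\<close>

text \<open>The total space of a map \<open>p\<close> enters through a metric \<open>M\<close> on it, the base as a
  topological space \<open>B\<close>.\<close>

definition fibre_measure_space :: "'e metric \<Rightarrow> 'b topology \<Rightarrow> ('e \<Rightarrow> 'b) \<Rightarrow> nat \<Rightarrow> 'e pmf topology"
  where "fibre_measure_space M B p k = subtopology (fin_measure_space M k)
    {\<mu>. \<exists>x\<in>topspace B. set_pmf \<mu> \<subseteq> {e \<in> mspace M. p e = x}}"

definition fibre_measure_proj :: "'e metric \<Rightarrow> 'b topology \<Rightarrow> ('e \<Rightarrow> 'b) \<Rightarrow> 'e pmf \<Rightarrow> 'b"
  where "fibre_measure_proj M B p \<mu> =
    (THE x. x \<in> topspace B \<and> set_pmf \<mu> \<subseteq> {e \<in> mspace M. p e = x})"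

lemma fibre_measure_proj_eqI:
  assumes "x \<in> topspace B" "set_pmf \<mu> \<subseteq> {e \<in> mspace M. p e = x}"
  shows "fibre_measure_proj M B p \<mu> = x"
proof -
  obtain e where "e \<in> set_pmf \<mu>" using set_pmf_not_empty by fast
  with assms show ?thesis unfolding fibre_measure_proj_def by (intro the_equality) auto
qed

definition is_section_of_measures ::
    "'e metric \<Rightarrow> 'b topology \<Rightarrow> ('e \<Rightarrow> 'b) \<Rightarrow> nat \<Rightarrow> ('b \<Rightarrow> 'e pmf) \<Rightarrow> bool"
  where "is_section_of_measures M B p k s \<longleftrightarrow>
    continuous_map B (fibre_measure_space M B p k) s \<and>
    (\<forall>b\<in>topspace B. fibre_measure_proj M B p (s b) = b)"

text \<open>The infimum in \<open>enat\<close> is the minimum if some \<open>n\<close> is admissible, and infinity otherwise.\<close>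

definition dsecat :: "'e metric \<Rightarrow> 'b topology \<Rightarrow> ('e \<Rightarrow> 'b) \<Rightarrow> enat"
  where "dsecat M B p = Inf {enat n | n. \<exists>s. is_section_of_measures M B p (n + 1) s}"

definition equivariant_dsecat ::
    "('g, 'z) monoid_scheme \<Rightarrow> ('g \<Rightarrow> 'e \<Rightarrow> 'e) \<Rightarrow> ('g \<Rightarrow> 'b \<Rightarrow> 'b) \<Rightarrow>
      'e metric \<Rightarrow> 'b topology \<Rightarrow> ('e \<Rightarrow> 'b) \<Rightarrow> enat"
  where "equivariant_dsecat G \<alpha> \<beta> M B p = Inf {enat n | n. \<exists>s.
    is_section_of_measures M B p (n + 1) s \<and>
    (\<forall>g\<in>carrier G. \<forall>b\<in>topspace B. s (\<beta> g b) = map_pmf (\<alpha> g) (s b))}"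

text \<open>In the next two definitions \<open>M\<close> is meant to be a metric for the compact-open topology
  on the space of vertical paths of \<open>p\<close>, respectively of all paths in \<open>X\<close>.\<close>

definition parametrized_dTC ::
    "nat \<Rightarrow> (real \<Rightarrow> 'e) metric \<Rightarrow> 'e topology \<Rightarrow> ('e \<Rightarrow> 'b) \<Rightarrow> enat"
  where "parametrized_dTC r M E p = dsecat M (fibre_power r E p) (path_eval r)"

definition equivariant_dTC ::
    "nat \<Rightarrow> ('g, 'z) monoid_scheme \<Rightarrow> (real \<Rightarrow> 'x) metric \<Rightarrow> 'x topology \<Rightarrow> ('g \<Rightarrow> 'x \<Rightarrow> 'x) \<Rightarrow> enat"
  where "equivariant_dTC r G M X \<phi> =
    equivariant_dsecat G (path_action \<phi>) (power_action r \<phi>) M (power_space r X) (path_eval r)"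

end

(* Write [f, x] for the class of (f, x) in the associated bundle E. A point of the fibre power of E
   is a tuple ([f_1, x], ..., [f_r, x]) with a common x. Given an equivariant section s over the
   power of F, send this point to the image of the measure s(f_1, ..., f_r) under the map
   gamma |-> [gamma(-), x]. Since s is equivariant and G acts freely on P, the result does not
   depend on the representative; local sections of P -> P/G make it continuous. The support does
   not grow, so even dTC_r[E -> P/G] <= dTC_{G,r}(F) holds, without the square. *)
theory Submission
  imports Defs
begin

section \<open>Continuity in the Levy-Prokhorov metric\<close>

lemma topspace_fin_measure_space: "topspace (fin_measure_space M k) = fin_measures M k"
  unfolding fin_measure_space_def by (simp add: Metric_space.topspace_mtopology Metric_space_LP_dist)

lemma openin_prob_greater:
  assumes "openin (mtopology_of M) U"
  shows "openin (fin_measure_space M k) {\<mu> \<in> fin_measures M k. c < measure_pmf.prob \<mu> U}"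
proof -
  interpret M: Metric_space "mspace M" "mdist M" by simp
  interpret LP: Metric_space "fin_measures M k" "LP_dist M" by (rule Metric_space_LP_dist)
  show ?thesis
    unfolding fin_measure_space_def LP.openin_mtopology
  proof (intro conjI allI impI)
    fix \<mu> assume "\<mu> \<in> {\<mu> \<in> fin_measures M k. c < measure_pmf.prob \<mu> U}"
    then have \<mu>: "\<mu> \<in> fin_measures M k" "c < measure_pmf.prob \<mu> U" by auto
    define S where "S = set_pmf \<mu> \<inter> U"
    have S: "finite S" "S \<subseteq> U" "U \<subseteq> mspace M"
      using \<mu> openin_subset[OF assms] by (auto simp: S_def fin_measures_def)
    have "\<forall>x\<in>S. \<exists>d>0. M.mball x d \<subseteq> U"
      using assms S(2) unfolding mtopology_of_def M.openin_mtopology by blast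
    then obtain d where d: "\<And>x. x \<in> S \<Longrightarrow> d x > 0 \<and> M.mball x (d x) \<subseteq> U" by metis
    define e where "e = Min (insert (measure_pmf.prob \<mu> U - c) (d ` S))"
    have e: "e > 0" "e \<le> measure_pmf.prob \<mu> U - c" "\<And>x. x \<in> S \<Longrightarrow> e \<le> d x"
      using S(1) \<mu>(2) d by (auto simp: e_def)
    have "\<nu> \<in> {\<mu> \<in> fin_measures M k. c < measure_pmf.prob \<mu> U}" if \<nu>: "\<nu> \<in> LP.mball \<mu> e" for \<nu>
    proof -
      have "LP_dist M \<mu> \<nu> < e" using \<nu> by simp
      then obtain \<delta> where \<delta>: "LP_close M \<mu> \<nu> \<delta>" "\<delta> < e" by (rule LP_dist_lessE)
      have "S \<in> borel_sets M"
      proof -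
        have "closedin M.mtopology S"
          using S M.t1_space_mtopology by (auto simp: t1_space_closedin_finite)
        then have "mspace M - S \<in> borel_sets M"
          by (auto simp: borel_sets_def closedin_def mtopology_of_def)
        then have "mspace M - (mspace M - S) \<in> borel_sets M"
          unfolding borel_sets_def by (rule sigma_sets.Compl)
        moreover have "mspace M - (mspace M - S) = S" using S by auto
        ultimately show ?thesis by simp
      qed
      have "measure_pmf.prob \<mu> U = measure_pmf.prob \<mu> S"
        unfolding S_def by (metis inf_commute measure_Int_set_pmf)
      also have "\<dots> \<le> measure_pmf.prob \<nu> (nbhd M \<delta> S) + \<delta>"
        using \<delta>(1) \<open>S \<in> borel_sets M\<close> by (auto simp: LP_close_def)
      also have "nbhd M \<delta> S \<subseteq> U"
      proof
        fix y assume "y \<in> nbhd M \<delta> S"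
        then obtain x where "x \<in> S" "y \<in> mspace M" "mdist M x y < \<delta>" by (auto simp: nbhd_def)
        then have "y \<in> M.mball x (d x)" using S \<delta>(2) e(3)[of x] by (auto simp: subset_iff)
        then show "y \<in> U" using d \<open>x \<in> S\<close> by blast
      qed
      then have "measure_pmf.prob \<nu> (nbhd M \<delta> S) \<le> measure_pmf.prob \<nu> U"
        by (intro measure_pmf.finite_measure_mono) auto
      finally show ?thesis using \<nu> \<delta>(2) e(2) by simp
    qed
    then show "\<exists>e>0. LP.mball \<mu> e \<subseteq> {\<mu> \<in> fin_measures M k. c < measure_pmf.prob \<mu> U}"
      using e(1) by blast
  qed auto
qed

lemma LP_close_if_balls:
  assumes \<mu>: "set_pmf \<mu> \<subseteq> mspace M" "finite (set_pmf \<mu>)" and e: "e > 0" and d: "d \<le> e"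
    and disj: "\<And>x y. x \<in> set_pmf \<mu> \<Longrightarrow> y \<in> set_pmf \<mu> \<Longrightarrow> x \<noteq> y \<Longrightarrow> nbhd M d {x} \<inter> nbhd M d {y} = {}"
    and ball: "\<And>x. x \<in> set_pmf \<mu> \<Longrightarrow> pmf \<mu> x - e / card (set_pmf \<mu>) < measure_pmf.prob \<nu> (nbhd M d {x})"
  shows "LP_close M \<mu> \<nu> e"
proof -
  have card: "card (set_pmf \<mu>) > 0" using \<mu> set_pmf_not_empty[of \<mu>] by (simp add: card_gt_0_iff)
  have le: "measure_pmf.prob \<mu> S \<le> measure_pmf.prob \<nu> (\<Union>x\<in>S. nbhd M d {x}) + e"
    if S: "S \<subseteq> set_pmf \<mu>" for S
  proof -
    have fS: "finite S" using S \<mu> finite_subset by blast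
    have "measure_pmf.prob \<mu> S = (\<Sum>x\<in>S. pmf \<mu> x)" using fS by (rule measure_measure_pmf_finite)
    also have "\<dots> \<le> (\<Sum>x\<in>S. measure_pmf.prob \<nu> (nbhd M d {x}) + e / card (set_pmf \<mu>))"
      by (intro sum_mono) (use ball S in force)
    also have "\<dots> = (\<Sum>x\<in>S. measure_pmf.prob \<nu> (nbhd M d {x})) + card S * (e / card (set_pmf \<mu>))"
      by (simp add: sum.distrib)
    also have "(\<Sum>x\<in>S. measure_pmf.prob \<nu> (nbhd M d {x})) = measure_pmf.prob \<nu> (\<Union>x\<in>S. nbhd M d {x})"
      using S disj fS by (intro measure_pmf.finite_measure_finite_Union[symmetric])
        (auto simp: disjoint_family_on_def subset_iff)
    also have "card S * (e / card (set_pmf \<mu>)) \<le> e"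
      using card_mono[OF \<mu>(2) S] card e by (simp add: field_simps)
    finally show ?thesis by simp
  qed
  have "measure_pmf.prob \<mu> A \<le> measure_pmf.prob \<nu> (nbhd M e A) + e \<and>
    measure_pmf.prob \<nu> A \<le> measure_pmf.prob \<mu> (nbhd M e A) + e" if A: "A \<in> borel_sets M" for A
  proof
    have "measure_pmf.prob \<mu> A = measure_pmf.prob \<mu> (A \<inter> set_pmf \<mu>)" by (simp add: measure_Int_set_pmf)
    also have "\<dots> \<le> measure_pmf.prob \<nu> (\<Union>x\<in>A \<inter> set_pmf \<mu>. nbhd M d {x}) + e" by (rule le) simp
    also have "measure_pmf.prob \<nu> (\<Union>x\<in>A \<inter> set_pmf \<mu>. nbhd M d {x}) \<le> measure_pmf.prob \<nu> (nbhd M e A)"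
      by (intro measure_pmf.finite_measure_mono) (use d in \<open>auto simp: nbhd_def intro: less_le_trans\<close>)
    finally show "measure_pmf.prob \<mu> A \<le> measure_pmf.prob \<nu> (nbhd M e A) + e" by simp
  next
    define S where "S = set_pmf \<mu> - nbhd M e A"
    have "A \<inter> (\<Union>x\<in>S. nbhd M d {x}) = {}"
    proof (rule equals0I)
      fix y assume "y \<in> A \<inter> (\<Union>x\<in>S. nbhd M d {x})"
      then obtain x where x: "y \<in> A" "x \<in> S" "mdist M x y < d" by (auto simp: nbhd_def)
      then have "mdist M y x < e" using d by (simp add: mdist_commute)
      then have "x \<in> nbhd M e A" using x \<mu> by (auto simp: nbhd_def S_def)
      then show False using x(2) by (simp add: S_def)
    qed
    then have "measure_pmf.prob \<nu> A \<le> measure_pmf.prob \<nu> (- (\<Union>x\<in>S. nbhd M d {x}))"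
      by (intro measure_pmf.finite_measure_mono) auto
    also have "\<dots> = 1 - measure_pmf.prob \<nu> (\<Union>x\<in>S. nbhd M d {x})"
      using measure_pmf.prob_compl[of "\<Union>x\<in>S. nbhd M d {x}" \<nu>] by (simp add: Compl_eq_Diff_UNIV)
    also have "\<dots> \<le> 1 - measure_pmf.prob \<mu> S + e" using le[of S] by (simp add: S_def)
    also have "1 - measure_pmf.prob \<mu> S = measure_pmf.prob \<mu> (- S)"
      using measure_pmf.prob_compl[of S \<mu>] by (simp add: Compl_eq_Diff_UNIV)
    also have "\<dots> = measure_pmf.prob \<mu> (- S \<inter> set_pmf \<mu>)" by (simp add: measure_Int_set_pmf)
    also have "\<dots> \<le> measure_pmf.prob \<mu> (nbhd M e A)"
      by (intro measure_pmf.finite_measure_mono) (auto simp: S_def)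
    finally show "measure_pmf.prob \<nu> A \<le> measure_pmf.prob \<mu> (nbhd M e A) + e" by simp
  qed
  then show ?thesis using e by (simp add: LP_close_def)
qed

text \<open>The right-hand side mentions the metric only through its topology, so it does not matter
  which metrics for the compact-open topologies are used.\<close>

lemma continuous_map_fin_measure_space_iff:
  "continuous_map Z (fin_measure_space M k) \<sigma> \<longleftrightarrow>
    \<sigma> ` topspace Z \<subseteq> fin_measures M k \<and>
    (\<forall>U c. openin (mtopology_of M) U \<longrightarrow> openin Z {z \<in> topspace Z. c < measure_pmf.prob (\<sigma> z) U})"
  (is "?cont \<longleftrightarrow> ?into \<and> ?lsc")
proof (intro iffI conjI allI impI)
  assume ?cont
  then show into: ?into
    using continuous_map_image_subset_topspace topspace_fin_measure_space by metis
  fix U and c :: real assume "openin (mtopology_of M) U"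
  then have "openin Z {z \<in> topspace Z. \<sigma> z \<in> {\<mu> \<in> fin_measures M k. c < measure_pmf.prob \<mu> U}}"
    using \<open>?cont\<close> by (intro openin_continuous_map_preimage[OF _ openin_prob_greater])
  moreover have "{z \<in> topspace Z. \<sigma> z \<in> {\<mu> \<in> fin_measures M k. c < measure_pmf.prob \<mu> U}} =
    {z \<in> topspace Z. c < measure_pmf.prob (\<sigma> z) U}"
    using into by auto
  ultimately show "openin Z {z \<in> topspace Z. c < measure_pmf.prob (\<sigma> z) U}" by simp
next
  assume "?into \<and> ?lsc"
  then have into: ?into and lsc: ?lsc by auto
  interpret LP: Metric_space "fin_measures M k" "LP_dist M" by (rule Metric_space_LP_dist)
  show ?cont
    unfolding fin_measure_space_def LP.continuous_map_to_metric
  proof (intro ballI allI impI)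
    fix z and \<epsilon> :: real assume z: "z \<in> topspace Z" and "\<epsilon> > 0"
    define \<mu> where "\<mu> = \<sigma> z"
    have \<mu>: "set_pmf \<mu> \<subseteq> mspace M" "finite (set_pmf \<mu>)"
      using into z by (auto simp: \<mu>_def fin_measures_def)
    define e where "e = \<epsilon> / 2"
    have e: "e > 0" "e < \<epsilon>" using \<open>\<epsilon> > 0\<close> by (auto simp: e_def)
    define D where "D = insert e ((\<lambda>(x, y). mdist M x y / 2) ` {(x, y) \<in> set_pmf \<mu> \<times> set_pmf \<mu>. x \<noteq> y})"
    define d where "d = Min D"
    have "finite {(x, y) \<in> set_pmf \<mu> \<times> set_pmf \<mu>. x \<noteq> y}"
      by (rule finite_subset[of _ "set_pmf \<mu> \<times> set_pmf \<mu>"]) (use \<mu>(2) in auto)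
    then have D: "finite D" "D \<noteq> {}" by (simp_all add: D_def)
    have "\<forall>t\<in>D. 0 < t"
      using e \<mu>(1) by (auto simp: D_def subset_iff order.strict_iff_order)
    then have d: "d > 0" "d \<le> e" using D by (auto simp: d_def D_def)
    have dist: "2 * d \<le> mdist M x y" if "x \<in> set_pmf \<mu>" "y \<in> set_pmf \<mu>" "x \<noteq> y" for x y
    proof -
      have "mdist M x y / 2 \<in> D" using that by (auto simp: D_def)
      then have "d \<le> mdist M x y / 2" using D unfolding d_def by (intro Min_le)
      then show ?thesis by simp
    qed
    define N where "N x = {z \<in> topspace Z. pmf \<mu> x - e / card (set_pmf \<mu>) < measure_pmf.prob (\<sigma> z) (nbhd M d {x})}" for x
    define W where "W = (\<Inter>x\<in>set_pmf \<mu>. N x)"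
    show "\<exists>W. openin Z W \<and> z \<in> W \<and> (\<forall>w\<in>W. \<sigma> w \<in> LP.mball (\<sigma> z) \<epsilon>)"
    proof (intro exI[of _ W] conjI ballI)
      have "openin Z (N x)" if "x \<in> set_pmf \<mu>" for x
        unfolding N_def using lsc nbhd_open[of "{x}" M d] that \<mu> by auto
      then show "openin Z W"
        unfolding W_def using \<mu> set_pmf_not_empty[of \<mu>] by (intro openin_INT2) auto
      have "z \<in> N x" if x: "x \<in> set_pmf \<mu>" for x
      proof -
        have "x \<in> mspace M" using x \<mu>(1) by blast
        then have "mdist M x x < d" using d(1) by (metis mdist_zero)
        with \<open>x \<in> mspace M\<close> have "x \<in> nbhd M d {x}" by (simp add: nbhd_def)
        then have "pmf \<mu> x \<le> measure_pmf.prob \<mu> (nbhd M d {x})"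
          unfolding measure_pmf_single[symmetric] by (intro measure_pmf.finite_measure_mono) auto
        moreover have "e / card (set_pmf \<mu>) > 0"
          using e \<mu> set_pmf_not_empty[of \<mu>] by (simp add: card_gt_0_iff)
        ultimately show ?thesis using z by (simp add: N_def \<mu>_def)
      qed
      then show "z \<in> W" by (auto simp: W_def)
      fix w assume w: "w \<in> W"
      then have "w \<in> topspace Z" using set_pmf_not_empty[of \<mu>] by (auto simp: W_def N_def)
      have "LP_close M \<mu> (\<sigma> w) e"
      proof (rule LP_close_if_balls[OF \<mu> e(1) d(2)])
        fix x y assume xy: "x \<in> set_pmf \<mu>" "y \<in> set_pmf \<mu>" "x \<noteq> y"
        show "nbhd M d {x} \<inter> nbhd M d {y} = {}"
        proof (rule equals0I)
          fix v assume "v \<in> nbhd M d {x} \<inter> nbhd M d {y}"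
          then have "v \<in> mspace M" "mdist M x v < d" "mdist M y v < d" by (auto simp: nbhd_def)
          then show False
            using dist[OF xy] mdist_triangle[of x M v y] xy \<mu> by (auto simp: mdist_commute subset_iff)
        qed
      qed (use w in \<open>auto simp: W_def N_def\<close>)
      then have "LP_dist M \<mu> (\<sigma> w) < \<epsilon>" using LP_dist_le e by fastforce
      then show "\<sigma> w \<in> LP.mball (\<sigma> z) \<epsilon>"
        using into z \<open>w \<in> topspace Z\<close> by (auto simp: \<mu>_def)
    qed
  qed
qed

lemma fin_measures_map_pmf:
  assumes "\<mu> \<in> fin_measures M k" "f ` set_pmf \<mu> \<subseteq> mspace N"
  shows "map_pmf f \<mu> \<in> fin_measures N k"
  using assms card_image_le[of "set_pmf \<mu>" f] by (auto simp: fin_measures_def)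

lemma continuous_map_pushforward:
  assumes g: "continuous_map Z (fin_measure_space M k) g" and \<xi>: "continuous_map Z X \<xi>"
    and m: "continuous_map (prod_topology (mtopology_of M) X) (mtopology_of N) (\<lambda>(y, x). m y x)"
  shows "continuous_map Z (fin_measure_space N k) (\<lambda>z. map_pmf (\<lambda>y. m y (\<xi> z)) (g z))"
proof -
  have gz: "g z \<in> fin_measures M k" "set_pmf (g z) \<subseteq> mspace M" "finite (set_pmf (g z))"
    if "z \<in> topspace Z" for z
    using g that unfolding continuous_map_fin_measure_space_iff by (auto simp: fin_measures_def)
  have \<xi>z: "\<xi> z \<in> topspace X" if "z \<in> topspace Z" for z
    using \<xi> that by (auto simp: continuous_map_def)
  have mN: "m y x \<in> mspace N" if "y \<in> mspace M" "x \<in> topspace X" for x y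
    using continuous_map_image_subset_topspace[OF m] that by force
  show ?thesis
    unfolding continuous_map_fin_measure_space_iff
  proof (intro conjI allI impI)
    show "(\<lambda>z. map_pmf (\<lambda>y. m y (\<xi> z)) (g z)) ` topspace Z \<subseteq> fin_measures N k"
      using gz \<xi>z mN by (auto intro!: fin_measures_map_pmf simp: subset_iff)
  next
    fix U and c :: real assume U: "openin (mtopology_of N) U"
    let ?L = "{z \<in> topspace Z. c < measure_pmf.prob (map_pmf (\<lambda>y. m y (\<xi> z)) (g z)) U}"
    show "openin Z ?L"
    proof (subst openin_subopen, intro ballI)
      fix z assume "z \<in> ?L"
      then have z: "z \<in> topspace Z" "c < measure_pmf.prob (g z) ((\<lambda>y. m y (\<xi> z)) -` U)" by auto
      define S where "S = set_pmf (g z) \<inter> (\<lambda>y. m y (\<xi> z)) -` U"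
      have S: "finite S" "S \<subseteq> mspace M" using gz[OF z(1)] by (auto simp: S_def)
      define R where
        "R = {p \<in> topspace (prod_topology (mtopology_of M) X). (case p of (y, x) \<Rightarrow> m y x) \<in> U}"
      have "openin (prod_topology (mtopology_of M) X) R"
        unfolding R_def using m U by (rule openin_continuous_map_preimage)
      moreover have "(y, \<xi> z) \<in> R" if "y \<in> S" for y
        using that S \<xi>z[OF z(1)] by (auto simp: S_def R_def)
      ultimately have "\<forall>y\<in>S. \<exists>V W. openin (mtopology_of M) V \<and> openin X W \<and> y \<in> V \<and> \<xi> z \<in> W \<and> V \<times> W \<subseteq> R"
        unfolding openin_prod_topology_alt by meson
      then obtain V W where VW: "\<And>y. y \<in> S \<Longrightarrow> openin (mtopology_of M) (V y) \<and> openin X (W y) \<and>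
        y \<in> V y \<and> \<xi> z \<in> W y \<and> V y \<times> W y \<subseteq> R" by metis
      define V' where "V' = (\<Union>y\<in>S. V y)"
      define W' where "W' = (\<Inter>y\<in>S. W y) \<inter> topspace X"
      have V': "openin (mtopology_of M) V'" using VW by (auto simp: V'_def)
      have W': "openin X W'"
        unfolding W'_def by (intro openin_INT) (use VW S in auto)
      have sub: "m y x \<in> U" if "y \<in> V'" "x \<in> W'" for x y
        proof -
        obtain y' where "y' \<in> S" "y \<in> V y'" "x \<in> W y'" using \<open>y \<in> V'\<close> \<open>x \<in> W'\<close> by (auto simp: V'_def W'_def)
        then have "(y, x) \<in> R" using VW by blast
        then show ?thesis by (simp add: R_def)
      qed
      define L where "L = {w \<in> topspace Z. c < measure_pmf.prob (g w) V'} \<inter> {w \<in> topspace Z. \<xi> w \<in> W'}"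
      show "\<exists>T. openin Z T \<and> z \<in> T \<and> T \<subseteq> ?L"
      proof (intro exI[of _ L] conjI subsetI)
        show "openin Z L"
          using g V' openin_continuous_map_preimage[OF \<xi> W']
          unfolding L_def continuous_map_fin_measure_space_iff by blast
        have "measure_pmf.prob (g z) ((\<lambda>y. m y (\<xi> z)) -` U) = measure_pmf.prob (g z) S"
          unfolding S_def by (metis inf_commute measure_Int_set_pmf)
        also have "\<dots> \<le> measure_pmf.prob (g z) V'"
          by (intro measure_pmf.finite_measure_mono) (use VW in \<open>auto simp: V'_def\<close>)
        finally show "z \<in> L" using z \<xi>z[OF z(1)] VW by (auto simp: L_def W'_def)
        fix w assume "w \<in> L"
        then have w: "w \<in> topspace Z" "c < measure_pmf.prob (g w) V'" "\<xi> w \<in> W'" by (auto simp: L_def)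
        have "measure_pmf.prob (g w) V' \<le> measure_pmf.prob (g w) ((\<lambda>y. m y (\<xi> w)) -` U)"
          by (intro measure_pmf.finite_measure_mono) (use sub w in auto)
        then show "w \<in> ?L" using w by simp
      qed
    qed
  qed
qed

lemma is_section_of_measures_iff:
  "is_section_of_measures M B p k s \<longleftrightarrow> continuous_map B (fin_measure_space M k) s \<and>
    (\<forall>b\<in>topspace B. set_pmf (s b) \<subseteq> {e \<in> mspace M. p e = b})"
proof -
  let ?in = "\<lambda>b x. set_pmf (s b) \<subseteq> {e \<in> mspace M. p e = x}"
  have "(\<exists>x\<in>topspace B. ?in b x) \<and> fibre_measure_proj M B p (s b) = b \<longleftrightarrow> ?in b b"
    if b: "b \<in> topspace B" for b
  proof
    assume "(\<exists>x\<in>topspace B. ?in b x) \<and> fibre_measure_proj M B p (s b) = b"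
    then obtain x where x: "x \<in> topspace B" "?in b x" "fibre_measure_proj M B p (s b) = b" by blast
    then show "?in b b" using fibre_measure_proj_eqI[OF x(1,2)] by simp
  next
    assume "?in b b"
    then show "(\<exists>x\<in>topspace B. ?in b x) \<and> fibre_measure_proj M B p (s b) = b"
      using b fibre_measure_proj_eqI[OF b] by blast
  qed
  then have "(\<forall>b\<in>topspace B. \<exists>x\<in>topspace B. ?in b x) \<and>
      (\<forall>b\<in>topspace B. fibre_measure_proj M B p (s b) = b) \<longleftrightarrow> (\<forall>b\<in>topspace B. ?in b b)"
    by (simp only: ball_conj_distrib[symmetric] cong: ball_cong)
  then show ?thesis
    unfolding is_section_of_measures_def fibre_measure_space_def continuous_map_in_subtopology
      Pi_iff mem_Collect_eq by (simp only: conj_assoc)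
qed

section \<open>Compact-open topology\<close>

lemma pathin_compact_subset_nbhd:
  assumes \<gamma>: "pathin X \<gamma>" and t: "t \<in> {0..1}" and A: "openin X A" "\<gamma> t \<in> A"
  obtains d where "d > 0" "\<gamma> ` ({0..1} \<inter> cball t d) \<subseteq> A"
proof -
  have "openin (top_of_set {0..1}) {s \<in> topspace (top_of_set {0..1}). \<gamma> s \<in> A}"
    using \<gamma> A(1) unfolding pathin_def by (rule openin_continuous_map_preimage)
  then obtain e where e: "e > 0" "ball t e \<inter> {0..1} \<subseteq> {s \<in> {0..1}. \<gamma> s \<in> A}"
    using t A(2) unfolding openin_contains_ball by auto
  have "\<gamma> ` ({0..1} \<inter> cball t (e / 2)) \<subseteq> A"
    using e by (fastforce simp: subset_iff)
  then show thesis using e that[of "e / 2"] by auto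
qed

lemma openin_path_space_image:
  assumes "compact K" "K \<subseteq> {0..1}" "openin X A"
  shows "openin (path_space X) {\<gamma> \<in> paths X. \<gamma> ` K \<subseteq> A}"
  unfolding path_space_def by (rule topology_generated_by_Basis) (use assms in auto)

lemma continuous_map_path_space_pointwise:
  assumes m: "continuous_map (prod_topology X Y) E (\<lambda>(x, y). m x y)"
  shows "continuous_map (prod_topology (path_space X) Y) (path_space E)
    (\<lambda>(\<gamma>, y). \<lambda>t\<in>{0..1}. m (\<gamma> t) y)"
  unfolding path_space_def[of E]
proof (rule continuous_on_generated_topo)
  let ?T = "prod_topology (path_space X) Y" and ?h = "\<lambda>(\<gamma>, y). \<lambda>t\<in>{0..1}. m (\<gamma> t) y"
  have into: "?h p \<in> paths E" if pT: "p \<in> topspace ?T" for p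
  proof -
    obtain \<gamma> y where p: "p = (\<gamma>, y)" "\<gamma> \<in> paths X" "y \<in> topspace Y"
      using pT by (cases p) (simp add: topspace_path_space)
    then have "pathin X \<gamma>" by (simp add: paths_def)
    then have "continuous_map (top_of_set {0..1}) (prod_topology X Y) (\<lambda>t. (\<gamma> t, y))"
      using p by (auto simp: pathin_def continuous_map_pairedI)
    from continuous_map_compose[OF this m]
    have "pathin E (\<lambda>t. m (\<gamma> t) y)" by (simp add: pathin_def o_def)
    then have "pathin E (\<lambda>t\<in>{0..1}. m (\<gamma> t) y)"
      unfolding pathin_def by (rule continuous_map_eq) auto
    then show ?thesis using p by (simp add: paths_def)
  qed
  show "?h ` topspace ?T \<subseteq> \<Union> {{\<gamma> \<in> paths E. \<gamma> ` K \<subseteq> U} |K U. compact K \<and> K \<subseteq> {0..1} \<and> openin E U}"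
    using into topspace_path_space[of E] unfolding path_space_def topology_generated_by_topspace by blast
  fix Q assume "Q \<in> {{\<gamma> \<in> paths E. \<gamma> ` K \<subseteq> U} |K U. compact K \<and> K \<subseteq> {0..1} \<and> openin E U}"
  then obtain K U where Q: "Q = {\<gamma> \<in> paths E. \<gamma> ` K \<subseteq> U}" and K: "compact K" "K \<subseteq> {0..1}"
    and U: "openin E U" by blast
  define R where "R = {p \<in> topspace (prod_topology X Y). (case p of (x, y) \<Rightarrow> m x y) \<in> U}"
  have R: "openin (prod_topology X Y) R"
    unfolding R_def using m U by (rule openin_continuous_map_preimage)
  show "openin ?T (?h -` Q \<inter> topspace ?T)"
  proof (subst openin_subopen, intro ballI)
    fix p assume "p \<in> ?h -` Q \<inter> topspace ?T"
    then obtain \<gamma> y where p: "p = (\<gamma>, y)" "\<gamma> \<in> paths X" "y \<in> topspace Y" "?h (\<gamma>, y) ` K \<subseteq> U"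
      by (auto simp: topspace_path_space Q)
    have \<gamma>: "pathin X \<gamma>" using p by (simp add: paths_def)
    have "\<exists>A C d. openin X A \<and> openin Y C \<and> y \<in> C \<and> A \<times> C \<subseteq> R \<and> d > 0 \<and> \<gamma> ` ({0..1} \<inter> cball t d) \<subseteq> A"
      if t: "t \<in> K" for t
    proof -
      have "\<gamma> t \<in> topspace X" using \<gamma> t K by (auto simp: pathin_def continuous_map_def)
      moreover have "?h (\<gamma>, y) t \<in> U" using p(4) t by blast
      then have "m (\<gamma> t) y \<in> U" using t K by (auto simp: subset_iff)
      ultimately have "(\<gamma> t, y) \<in> R" using p by (simp add: R_def)
      then obtain A C where "openin X A" "openin Y C" "\<gamma> t \<in> A" "y \<in> C" "A \<times> C \<subseteq> R"
        using R unfolding openin_prod_topology_alt by meson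
      moreover then obtain d where "d > 0" "\<gamma> ` ({0..1} \<inter> cball t d) \<subseteq> A"
        using pathin_compact_subset_nbhd[OF \<gamma>, of t A] t K by blast
      ultimately show ?thesis by blast
    qed
    then obtain A C d where AC: "\<And>t. t \<in> K \<Longrightarrow> openin X (A t) \<and> openin Y (C t) \<and> y \<in> C t \<and>
      A t \<times> C t \<subseteq> R \<and> d t > 0 \<and> \<gamma> ` ({0..1} \<inter> cball t (d t)) \<subseteq> A t" by metis
    have "K \<subseteq> (\<Union>t\<in>K. ball t (d t))" using AC by force
    then obtain D where D: "D \<subseteq> K" "finite D" "K \<subseteq> (\<Union>t\<in>D. ball t (d t))"
      using compactE_image[OF K(1), of K "\<lambda>t. ball t (d t)"] by blast
    define V where "V = (\<Inter>t\<in>D. {\<beta> \<in> paths X. \<beta> ` (K \<inter> cball t (d t)) \<subseteq> A t}) \<inter> topspace (path_space X)"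
    define W where "W = (\<Inter>t\<in>D. C t) \<inter> topspace Y"
    show "\<exists>T. openin ?T T \<and> p \<in> T \<and> T \<subseteq> ?h -` Q \<inter> topspace ?T"
    proof (intro exI[of _ "V \<times> W"] conjI subsetI)
      have "openin (path_space X) V"
        unfolding V_def using D AC K by (intro openin_INT openin_path_space_image) auto
      moreover have "openin Y W"
        unfolding W_def using D AC by (intro openin_INT) auto
      ultimately show "openin ?T (V \<times> W)" by (simp add: openin_prod_Times_iff)
      have "\<gamma> ` (K \<inter> cball t (d t)) \<subseteq> A t" if "t \<in> D" for t
        using AC[of t] that D K by blast
      then show "p \<in> V \<times> W"
        using p AC D by (auto simp: V_def W_def topspace_path_space)
      fix w assume "w \<in> V \<times> W"
      then obtain \<beta> z where w: "w = (\<beta>, z)" "\<beta> \<in> V" "z \<in> W" by auto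
      have wT: "w \<in> topspace ?T" using w by (auto simp: V_def W_def)
      have "m (\<beta> t) z \<in> U" if t: "t \<in> K" for t
      proof -
        obtain s where s: "s \<in> D" "t \<in> ball s (d s)" using D(3) t by blast
        then have "\<beta> t \<in> A s" using w t by (auto simp: V_def subset_iff)
        moreover have "z \<in> C s" using w s by (auto simp: W_def)
        ultimately have "(\<beta> t, z) \<in> R" using AC s D by blast
        then show ?thesis by (simp add: R_def)
      qed
      then have "?h w ` K \<subseteq> U" using w K by auto
      then show "w \<in> ?h -` Q \<inter> topspace ?T" using into[OF wT] wT by (simp add: Q)
    qed
  qed
qed

section \<open>Local lifts in associated bundles\<close>

locale associated_bundle =
  fixes G :: "('g, 'z) monoid_scheme" (structure) and TG :: "'g topology"
    and F :: "'f topology" and \<phi> :: "'g \<Rightarrow> 'f \<Rightarrow> 'f"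
    and P :: "'p topology" and \<psi> :: "'g \<Rightarrow> 'p \<Rightarrow> 'p"
    and B :: "'b topology" and q :: "'p \<Rightarrow> 'b"
  assumes F_space: "G_space G TG F \<phi>"
    and principal: "principal_bundle G TG P \<psi> B q"
begin

abbreviation cls :: "'f \<Rightarrow> 'p \<Rightarrow> ('f \<times> 'p) set"
  where "cls f x \<equiv> orbit G (diagonal_action \<phi> \<psi>) (f, x)"

abbreviation E :: "('f \<times> 'p) set topology"
  where "E \<equiv> assoc_space G F \<phi> P \<psi>"

lemma P_space: "G_space G TG P \<psi>"
  using principal by (simp add: principal_bundle_def)

sublocale group G
  using F_space by (simp add: G_space_def topological_group_def)

sublocale F: group_action G "topspace F" \<phi>
  using F_space by (simp add: G_space_def)

sublocale P: group_action G "topspace P" \<psi>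
  using P_space by (simp add: G_space_def)

lemma topspace_TG: "topspace TG = carrier G"
  and continuous_map_inv: "continuous_map TG TG (\<lambda>x. inv x)"
  and continuous_map_F_action: "continuous_map (prod_topology TG F) F (\<lambda>(g, f). \<phi> g f)"
  and continuous_map_P_action: "continuous_map (prod_topology TG P) P (\<lambda>(g, x). \<psi> g x)"
  using F_space P_space by (simp_all add: G_space_def topological_group_def)

lemma F_closed: "g \<in> carrier G \<Longrightarrow> f \<in> topspace F \<Longrightarrow> \<phi> g f \<in> topspace F"
  using F.element_image by blast

lemma P_closed: "g \<in> carrier G \<Longrightarrow> x \<in> topspace P \<Longrightarrow> \<psi> g x \<in> topspace P"
  using P.element_image by blast

lemma F_one: "f \<in> topspace F \<Longrightarrow> \<phi> \<one> f = f"
  using F.id_eq_one by (metis restrict_apply')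

lemma P_one: "x \<in> topspace P \<Longrightarrow> \<psi> \<one> x = x"
  using P.id_eq_one by (metis restrict_apply')

lemma F_inv: "g \<in> carrier G \<Longrightarrow> f \<in> topspace F \<Longrightarrow> \<phi> (inv g) (\<phi> g f) = f"
  using F.orbit_sym_aux by blast

lemma P_inv: "g \<in> carrier G \<Longrightarrow> x \<in> topspace P \<Longrightarrow> \<psi> (inv g) (\<psi> g x) = x"
  using P.orbit_sym_aux by blast

lemma orbit_action_eq:
  assumes "g \<in> carrier G" "\<And>h. h \<in> carrier G \<Longrightarrow> \<alpha> (h \<otimes> g) y = \<alpha> h (\<alpha> g y)"
    and "\<And>h. h \<in> carrier G \<Longrightarrow> \<alpha> (h \<otimes> inv g) (\<alpha> g y) = \<alpha> h (\<alpha> (inv g) (\<alpha> g y))"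
    and "\<alpha> (inv g) (\<alpha> g y) = y"
  shows "orbit G \<alpha> (\<alpha> g y) = orbit G \<alpha> y"
proof (intro equalityI subsetI)
  fix z assume "z \<in> orbit G \<alpha> (\<alpha> g y)"
  then obtain h where "h \<in> carrier G" "z = \<alpha> h (\<alpha> g y)" by (auto simp: orbit_def)
  then have "h \<otimes> g \<in> carrier G" "z = \<alpha> (h \<otimes> g) y" using assms by auto
  then show "z \<in> orbit G \<alpha> y" by (auto simp: orbit_def)
next
  fix z assume "z \<in> orbit G \<alpha> y"
  then obtain h where "h \<in> carrier G" "z = \<alpha> h y" by (auto simp: orbit_def)
  then have "h \<otimes> inv g \<in> carrier G" "z = \<alpha> (h \<otimes> inv g) (\<alpha> g y)" using assms by auto
  then show "z \<in> orbit G \<alpha> (\<alpha> g y)" by (auto simp: orbit_def)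
qed

lemma orbit_P_eq_iff:
  assumes "x \<in> topspace P" "x' \<in> topspace P"
  shows "orbit G \<psi> x = orbit G \<psi> x' \<longleftrightarrow> (\<exists>g\<in>carrier G. x' = \<psi> g x)"
proof
  assume "orbit G \<psi> x = orbit G \<psi> x'"
  then have "x' \<in> orbit G \<psi> x" using P.orbit_refl[OF assms(2)] by simp
  then show "\<exists>g\<in>carrier G. x' = \<psi> g x" by (auto simp: orbit_def)
next
  assume "\<exists>g\<in>carrier G. x' = \<psi> g x"
  then obtain g where "g \<in> carrier G" "x' = \<psi> g x" by blast
  then show "orbit G \<psi> x = orbit G \<psi> x'"
    using assms P.composition_rule P_inv P_closed by (simp add: orbit_action_eq)
qed

lemma cls_eq_iff:
  assumes "f \<in> topspace F" "x \<in> topspace P" "f' \<in> topspace F" "x' \<in> topspace P"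
  shows "cls f x = cls f' x' \<longleftrightarrow> (\<exists>g\<in>carrier G. f' = \<phi> g f \<and> x' = \<psi> g x)"
proof
  have "(f', x') \<in> cls f' x'"
    using F_one P_one assms by (force simp: orbit_def diagonal_action_def)
  moreover assume "cls f x = cls f' x'"
  ultimately have "(f', x') \<in> cls f x" by simp
  then show "\<exists>g\<in>carrier G. f' = \<phi> g f \<and> x' = \<psi> g x"
    by (auto simp: orbit_def diagonal_action_def)
next
  assume "\<exists>g\<in>carrier G. f' = \<phi> g f \<and> x' = \<psi> g x"
  then obtain g where g: "g \<in> carrier G" "f' = \<phi> g f" "x' = \<psi> g x" by blast
  have "orbit G (diagonal_action \<phi> \<psi>) (diagonal_action \<phi> \<psi> g (f, x)) = cls f x"
    using g assms by (intro orbit_action_eq)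
      (simp_all add: diagonal_action_def F.composition_rule P.composition_rule
        F_inv P_inv F_closed P_closed)
  then show "cls f x = cls f' x'" using g by (simp add: diagonal_action_def)
qed

lemma topspace_E: "topspace E = {cls f x | f x. f \<in> topspace F \<and> x \<in> topspace P}"
  by (auto simp: assoc_space_def topspace_orbit_space orbits_def)

lemma continuous_map_cls: "continuous_map (prod_topology F P) E (\<lambda>(f, x). cls f x)"
  using quotient_imp_continuous_map[OF quotient_map_orbit] by (simp add: assoc_space_def case_prod_unfold)

text \<open>\<open>\<kappa> x\<close> is the inverse of the group coordinate of \<open>x\<close> in a trivialization, so that
  \<open>\<psi> (\<kappa> x) x\<close> depends only on the orbit of \<open>x\<close>.\<close>

lemma local_coordinate:
  assumes "x\<^sub>0 \<in> topspace P"
  obtains U \<kappa> where "openin P U" "x\<^sub>0 \<in> U" "continuous_map (subtopology P U) TG \<kappa>"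
    "\<And>x g. x \<in> U \<Longrightarrow> g \<in> carrier G \<Longrightarrow> \<psi> g x \<in> U \<and> \<kappa> (\<psi> g x) = \<kappa> x \<otimes> inv g"
proof -
  have q: "continuous_map P B q" using principal by (simp add: principal_bundle_def)
  then have "q x\<^sub>0 \<in> topspace B" using assms by (auto simp: continuous_map_def)
  then obtain V h where V: "openin B V" "q x\<^sub>0 \<in> V"
    and h: "homeomorphic_map (prod_topology (subtopology B V) TG)
      (subtopology P {x \<in> topspace P. q x \<in> V}) h"
    and hq: "\<forall>u\<in>V. \<forall>k\<in>carrier G. q (h (u, k)) = u"
    and h\<psi>: "\<forall>u\<in>V. \<forall>k\<in>carrier G. \<forall>g\<in>carrier G. h (u, g \<otimes> k) = \<psi> g (h (u, k))"
    using principal unfolding principal_bundle_def by blast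
  define U where "U = {x \<in> topspace P. q x \<in> V}"
  obtain k where k: "homeomorphic_maps (prod_topology (subtopology B V) TG) (subtopology P U) h k"
    using h unfolding U_def homeomorphic_map_maps by blast
  then have k_cont: "continuous_map (subtopology P U) (prod_topology (subtopology B V) TG) k"
    and kh: "\<And>u a. u \<in> topspace B \<Longrightarrow> u \<in> V \<Longrightarrow> a \<in> carrier G \<Longrightarrow> k (h (u, a)) = (u, a)"
    and hk: "\<And>x. x \<in> U \<Longrightarrow> h (k x) = x"
    by (auto simp: homeomorphic_maps_def topspace_TG U_def)
  define \<kappa> where "\<kappa> x = inv (snd (k x))" for x
  show thesis
  proof
    show "openin P U" unfolding U_def using q V(1) by (rule openin_continuous_map_preimage)
    show "x\<^sub>0 \<in> U" using assms V by (simp add: U_def)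
    have "continuous_map (subtopology P U) TG (\<lambda>x. snd (k x))"
      using continuous_map_compose[OF k_cont continuous_map_snd] by (simp add: o_def)
    from continuous_map_compose[OF this continuous_map_inv]
    show "continuous_map (subtopology P U) TG \<kappa>" by (simp add: \<kappa>_def[abs_def] o_def)
    fix x g assume x: "x \<in> U" and g: "g \<in> carrier G"
    obtain u a where ua: "k x = (u, a)" by (cases "k x")
    moreover have "k x \<in> topspace (prod_topology (subtopology B V) TG)"
      using k_cont x by (auto simp: continuous_map_def U_def)
    ultimately have u: "u \<in> topspace B" "u \<in> V" and a: "a \<in> carrier G" by (auto simp: topspace_TG)
    have "\<psi> g x = h (u, g \<otimes> a)" using hk[OF x] ua h\<psi> u a g by simp
    moreover have "\<psi> g x \<in> topspace P" using x g P_closed by (simp add: U_def)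
    ultimately have "\<psi> g x \<in> U" "k (\<psi> g x) = (u, g \<otimes> a)" using hq kh u a g by (auto simp: U_def)
    then show "\<psi> g x \<in> U \<and> \<kappa> (\<psi> g x) = \<kappa> x \<otimes> inv g"
      using a g ua by (simp add: \<kappa>_def inv_mult_group)
  qed
qed

lemma P_free:
  assumes x: "x \<in> topspace P" and g: "g \<in> carrier G" "\<psi> g x = x"
  shows "g = \<one>"
proof -
  obtain U \<kappa> where U: "x \<in> U" "continuous_map (subtopology P U) TG \<kappa>"
    "\<And>x g. x \<in> U \<Longrightarrow> g \<in> carrier G \<Longrightarrow> \<psi> g x \<in> U \<and> \<kappa> (\<psi> g x) = \<kappa> x \<otimes> inv g"
    using local_coordinate[OF x] by metis
  have "\<kappa> x \<in> carrier G" using U x by (auto simp: continuous_map_def topspace_TG)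
  moreover have "\<kappa> x \<otimes> inv g = \<kappa> x" using U(3)[of x g] U(1) g by simp
  ultimately show ?thesis using g(1) by simp
qed

lemma local_lift:
  assumes x\<^sub>0: "x\<^sub>0 \<in> topspace P"
  obtains W \<theta> where "openin E W" "\<And>f. f \<in> topspace F \<Longrightarrow> cls f x\<^sub>0 \<in> W"
    "continuous_map (subtopology E W) (prod_topology F P) \<theta>"
    "\<And>c. c \<in> W \<Longrightarrow> cls (fst (\<theta> c)) (snd (\<theta> c)) = c"
    "\<And>c d. c \<in> W \<Longrightarrow> d \<in> topspace E \<Longrightarrow> assoc_proj c = assoc_proj d \<Longrightarrow> d \<in> W \<and> snd (\<theta> d) = snd (\<theta> c)"
proof -
  obtain U \<kappa> where U: "openin P U" "x\<^sub>0 \<in> U" and \<kappa>: "continuous_map (subtopology P U) TG \<kappa>"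
    and \<kappa>\<psi>: "\<And>x g. x \<in> U \<Longrightarrow> g \<in> carrier G \<Longrightarrow> \<psi> g x \<in> U \<and> \<kappa> (\<psi> g x) = \<kappa> x \<otimes> inv g"
    using local_coordinate[OF x\<^sub>0] by metis
  have UP: "\<And>x. x \<in> U \<Longrightarrow> x \<in> topspace P" using U(1) openin_subset by blast
  have \<kappa>G: "\<kappa> x \<in> carrier G" if "x \<in> U" for x
    using \<kappa> that UP by (auto simp: continuous_map_def topspace_TG)
  have inv_P: "\<psi> (\<kappa> (\<psi> g x)) (\<psi> g x) = \<psi> (\<kappa> x) x" if "x \<in> U" "g \<in> carrier G" for g x
    using that \<kappa>G UP P_closed by (simp add: \<kappa>\<psi> P.composition_rule P_inv)
  have inv_F: "\<phi> (\<kappa> (\<psi> g x)) (\<phi> g f) = \<phi> (\<kappa> x) f"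
    if "x \<in> U" "g \<in> carrier G" "f \<in> topspace F" for f g x
    using that \<kappa>G F_closed by (simp add: \<kappa>\<psi> F.composition_rule F_inv)
  define \<zeta> where "\<zeta> = (\<lambda>(f, x). (\<phi> (\<kappa> x) f, \<psi> (\<kappa> x) x))"
  define \<theta> where "\<theta> c = \<zeta> (SOME p. p \<in> c)" for c
  define W where "W = {cls f x | f x. f \<in> topspace F \<and> x \<in> U}"
  have \<theta>: "\<theta> (cls f x) = (\<phi> (\<kappa> x) f, \<psi> (\<kappa> x) x)" if "f \<in> topspace F" "x \<in> U" for f x
  proof -
    have "(f, x) \<in> cls f x"
      using F_one P_one that UP by (force simp: orbit_def diagonal_action_def)
    then have "(SOME p. p \<in> cls f x) \<in> cls f x" by (rule someI)
    then obtain g where "g \<in> carrier G" "(SOME p. p \<in> cls f x) = (\<phi> g f, \<psi> g x)"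
      by (auto simp: orbit_def diagonal_action_def)
    then show ?thesis using that inv_P inv_F by (simp add: \<theta>_def \<zeta>_def)
  qed
  have W_iff: "cls f x \<in> W \<longleftrightarrow> x \<in> U" if fx: "f \<in> topspace F" "x \<in> topspace P" for f x
  proof
    assume "cls f x \<in> W"
    then obtain f' x' where *: "f' \<in> topspace F" "x' \<in> U" "cls f' x' = cls f x" by (auto simp: W_def)
    then obtain g where "g \<in> carrier G" "x = \<psi> g x'" using cls_eq_iff[of f' x' f x] UP fx by blast
    then show "x \<in> U" using \<kappa>\<psi> * by simp
  qed (use fx in \<open>auto simp: W_def\<close>)
  show thesis
  proof
    have pre: "{p \<in> topspace (prod_topology F P). orbit G (diagonal_action \<phi> \<psi>) p \<in> W} = topspace F \<times> U"
      using W_iff UP by auto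
    have "W \<subseteq> orbits G (topspace (prod_topology F P)) (diagonal_action \<phi> \<psi>)"
      using UP by (auto simp: W_def orbits_def)
    then show W: "openin E W"
      unfolding assoc_space_def openin_orbit_space pre by (simp add: openin_prod_Times_iff U)
    show "cls f x\<^sub>0 \<in> W" if "f \<in> topspace F" for f using that U by (auto simp: W_def)
    let ?S = "subtopology (prod_topology F P) (topspace F \<times> U)"
    have quot: "quotient_map ?S (subtopology E W) (orbit G (diagonal_action \<phi> \<psi>))"
      using quotient_map_restriction[OF quotient_map_orbit pre] W by (simp add: assoc_space_def)
    have f: "continuous_map ?S F fst" and x: "continuous_map ?S P snd"
      by (auto intro: continuous_map_from_subtopology continuous_map_fst continuous_map_snd)
    have "continuous_map ?S (subtopology P U) snd"
      using x by (auto simp: continuous_map_in_subtopology)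
    from continuous_map_compose[OF this \<kappa>] have \<kappa>': "continuous_map ?S TG (\<lambda>p. \<kappa> (snd p))"
      by (simp add: o_def)
    have "continuous_map ?S F (\<lambda>p. \<phi> (\<kappa> (snd p)) (fst p))"
      using continuous_map_compose[OF continuous_map_pairedI[OF \<kappa>' f] continuous_map_F_action]
      by (simp add: o_def)
    moreover have "continuous_map ?S P (\<lambda>p. \<psi> (\<kappa> (snd p)) (snd p))"
      using continuous_map_compose[OF continuous_map_pairedI[OF \<kappa>' x] continuous_map_P_action]
      by (simp add: o_def)
    ultimately have "continuous_map ?S (prod_topology F P)
        (\<lambda>p. (\<phi> (\<kappa> (snd p)) (fst p), \<psi> (\<kappa> (snd p)) (snd p)))"
      by (rule continuous_map_pairedI)
    then have "continuous_map ?S (prod_topology F P) (\<theta> \<circ> orbit G (diagonal_action \<phi> \<psi>))"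
      by (rule continuous_map_eq) (use \<theta> in auto)
    then show "continuous_map (subtopology E W) (prod_topology F P) \<theta>"
      by (rule continuous_compose_quotient_map[OF quot])
  next
    fix c assume "c \<in> W"
    then obtain f x where c: "c = cls f x" "f \<in> topspace F" "x \<in> U" by (auto simp: W_def)
    then show "cls (fst (\<theta> c)) (snd (\<theta> c)) = c"
      using \<theta> cls_eq_iff[of f x "\<phi> (\<kappa> x) f" "\<psi> (\<kappa> x) x"] \<kappa>G UP F_closed P_closed by auto
    fix d assume "d \<in> topspace E" "assoc_proj c = assoc_proj d"
    then obtain f' x' where d: "d = cls f' x'" "f' \<in> topspace F" "x' \<in> topspace P"
      and "orbit G \<psi> x = orbit G \<psi> x'"
      using c by (auto simp: topspace_E assoc_proj_orbit)
    then obtain g where g: "g \<in> carrier G" "x' = \<psi> g x" using orbit_P_eq_iff c UP by blast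
    then have "x' \<in> U" using \<kappa>\<psi> c by simp
    then show "d \<in> W \<and> snd (\<theta> d) = snd (\<theta> c)"
      using c d g \<theta> inv_P by (auto simp: W_def)
  qed
qed

section \<open>The induced section\<close>

definition path_cls :: "(real \<Rightarrow> 'f) \<Rightarrow> 'p \<Rightarrow> real \<Rightarrow> ('f \<times> 'p) set"
  where "path_cls \<gamma> x = (\<lambda>t\<in>{0..1}. cls (\<gamma> t) x)"

definition tuple_cls :: "nat \<Rightarrow> (nat \<Rightarrow> 'f) \<Rightarrow> 'p \<Rightarrow> nat \<Rightarrow> ('f \<times> 'p) set"
  where "tuple_cls r f x = (\<lambda>i\<in>{..<r}. cls (f i) x)"

lemma path_closed: "\<gamma> \<in> paths F \<Longrightarrow> t \<in> {0..1} \<Longrightarrow> \<gamma> t \<in> topspace F"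
  by (auto simp: paths_def pathin_def continuous_map_def)

lemma continuous_map_path_cls:
  "continuous_map (prod_topology (path_space F) P) (vertical_path_space E assoc_proj)
    (\<lambda>(\<gamma>, x). path_cls \<gamma> x)"
proof -
  have "\<exists>b. \<forall>t\<in>{0..1}. assoc_proj (path_cls \<gamma> x t) = b" for \<gamma> x
    by (rule exI[of _ "orbit G \<psi> x"]) (simp add: path_cls_def assoc_proj_orbit)
  moreover have "continuous_map (prod_topology (path_space F) P) (path_space E) (\<lambda>(\<gamma>, x). path_cls \<gamma> x)"
    unfolding path_cls_def by (rule continuous_map_path_space_pointwise[OF continuous_map_cls])
  ultimately show ?thesis
    unfolding vertical_path_space_def continuous_map_in_subtopology by (simp add: split_beta)
qed

lemma path_cls_action:
  assumes "g \<in> carrier G" "\<gamma> \<in> paths F" "x \<in> topspace P"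
  shows "path_cls (path_action \<phi> g \<gamma>) (\<psi> g x) = path_cls \<gamma> x"
proof
  fix t
  show "path_cls (path_action \<phi> g \<gamma>) (\<psi> g x) t = path_cls \<gamma> x t"
  proof (cases "t \<in> {0..1}")
    case True
    then have "cls (\<gamma> t) x = cls (\<phi> g (\<gamma> t)) (\<psi> g x)"
      using assms path_closed[of \<gamma> t] F_closed P_closed by (subst cls_eq_iff) auto
    then show ?thesis using True by (simp add: path_cls_def path_action_def)
  qed (auto simp: path_cls_def)
qed

lemma path_eval_path_cls:
  assumes "r \<ge> 2"
  shows "path_eval r (path_cls \<gamma> x) = tuple_cls r (path_eval r \<gamma>) x"
proof
  fix i
  have "real i / real (r - 1) \<in> {0..1}" if "i < r" using assms that by simp
  then show "path_eval r (path_cls \<gamma> x) i = tuple_cls r (path_eval r \<gamma>) x i"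
    by (simp add: path_eval_def path_cls_def tuple_cls_def)
qed

lemma tuple_cls_eq_imp:
  assumes "r > 0" and f: "f \<in> topspace (power_space r F)" "f' \<in> topspace (power_space r F)"
    and x: "x \<in> topspace P" "x' \<in> topspace P" and eq: "tuple_cls r f x = tuple_cls r f' x'"
  obtains g where "g \<in> carrier G" "x' = \<psi> g x" "f' = power_action r \<phi> g f"
proof -
  have fi: "f i \<in> topspace F" "f' i \<in> topspace F" if "i < r" for i
    using f that by (auto simp: power_space_def PiE_iff)
  have "cls (f i) x = cls (f' i) x'" if "i < r" for i
    using fun_cong[OF eq, of i] that by (simp add: tuple_cls_def)
  then have "\<exists>g\<in>carrier G. f' i = \<phi> g (f i) \<and> x' = \<psi> g x" if "i < r" for i
    using cls_eq_iff[OF fi(1) x(1) fi(2) x(2)] that by simp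
  then obtain h where h: "\<And>i. i < r \<Longrightarrow> h i \<in> carrier G \<and> f' i = \<phi> (h i) (f i) \<and> x' = \<psi> (h i) x"
    by metis
  have h_const: "h i = h 0" if "i < r" for i
  proof -
    have hi: "h i \<in> carrier G" "h 0 \<in> carrier G" "\<psi> (h i) x = \<psi> (h 0) x"
      using h that \<open>r > 0\<close> by auto
    then have "\<psi> (inv (h 0) \<otimes> h i) x = x"
      using x by (simp add: P.composition_rule P_inv)
    then have "inv (h 0) \<otimes> h i = \<one>" using P_free x hi by simp
    then have "inv (h 0) = inv (h i)" using hi inv_equality[of "inv (h 0)" "h i"] by simp
    then show ?thesis using hi by (metis inv_inv)
  qed
  have "f' = power_action r \<phi> (h 0) f"
  proof
    fix i
    show "f' i = power_action r \<phi> (h 0) f i"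
      using h[of i] h_const[of i] f(2) by (cases "i < r") (auto simp: power_action_def power_space_def PiE_iff extensional_def)
  qed
  then show thesis using that h \<open>r > 0\<close> by blast
qed

lemma fibre_power_local_lift:
  assumes r: "r > 0" and e\<^sub>0: "e\<^sub>0 \<in> topspace (fibre_power r E assoc_proj)"
  obtains T \<tau> \<xi> where "openin (fibre_power r E assoc_proj) T" "e\<^sub>0 \<in> T"
    "continuous_map (subtopology (fibre_power r E assoc_proj) T) (power_space r F) \<tau>"
    "continuous_map (subtopology (fibre_power r E assoc_proj) T) P \<xi>"
    "\<And>e. e \<in> T \<Longrightarrow> tuple_cls r (\<tau> e) (\<xi> e) = e"
proof -
  let ?Z = "fibre_power r E assoc_proj"
  have Z: "e i \<in> topspace E" "assoc_proj (e i) = assoc_proj (e 0)" "e \<in> extensional {..<r}"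
    if "e \<in> topspace ?Z" "i < r" for e i
  proof -
    have "e \<in> ({..<r} \<rightarrow>\<^sub>E topspace E)" and "\<forall>i<r. \<forall>j<r. assoc_proj (e i) = assoc_proj (e j)"
      using that(1)
      unfolding fibre_power_def power_space_def topspace_subtopology topspace_product_topology o_def
      by blast+
    then show "e i \<in> topspace E" "assoc_proj (e i) = assoc_proj (e 0)" "e \<in> extensional {..<r}"
      using \<open>i < r\<close> r by (blast, blast, simp add: PiE_iff)
  qed
  have proj: "continuous_map ?Z E (\<lambda>e. e i)" if "i < r" for i
    unfolding fibre_power_def power_space_def using that
    by (intro continuous_map_from_subtopology continuous_map_product_projection) simp
  obtain f\<^sub>0 x\<^sub>0 where "e\<^sub>0 0 = cls f\<^sub>0 x\<^sub>0" and f\<^sub>0: "f\<^sub>0 \<in> topspace F" and x\<^sub>0: "x\<^sub>0 \<in> topspace P"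
    using Z(1)[OF e\<^sub>0 r] by (auto simp: topspace_E)
  obtain W \<theta> where W: "openin E W" "\<And>f. f \<in> topspace F \<Longrightarrow> cls f x\<^sub>0 \<in> W"
    and \<theta>: "continuous_map (subtopology E W) (prod_topology F P) \<theta>"
    and cls\<theta>: "\<And>c. c \<in> W \<Longrightarrow> cls (fst (\<theta> c)) (snd (\<theta> c)) = c"
    and proj\<theta>: "\<And>c d. c \<in> W \<Longrightarrow> d \<in> topspace E \<Longrightarrow> assoc_proj c = assoc_proj d \<Longrightarrow>
      d \<in> W \<and> snd (\<theta> d) = snd (\<theta> c)"
    by (rule local_lift[OF x\<^sub>0]) (rule that)
  define T where "T = {e \<in> topspace ?Z. e 0 \<in> W}"
  have T: "e i \<in> W" "snd (\<theta> (e i)) = snd (\<theta> (e 0))" if "e \<in> T" "i < r" for e i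
    using proj\<theta>[of "e 0" "e i"] Z[of e i] that by (auto simp: T_def)
  have \<theta>T: "continuous_map (subtopology ?Z T) (prod_topology F P) (\<lambda>e. \<theta> (e i))" if i: "i < r" for i
  proof -
    have "continuous_map (subtopology ?Z T) (subtopology E W) (\<lambda>e. e i)"
      unfolding continuous_map_in_subtopology
      using T(1) i proj[OF i] by (auto intro: continuous_map_from_subtopology)
    from continuous_map_compose[OF this \<theta>] show ?thesis by (simp add: o_def)
  qed
  show thesis
  proof
    show "openin ?Z T"
      unfolding T_def using proj[OF r] W(1) by (rule openin_continuous_map_preimage)
    show "e\<^sub>0 \<in> T"
      using e\<^sub>0 W(2)[OF f\<^sub>0] \<open>e\<^sub>0 0 = cls f\<^sub>0 x\<^sub>0\<close> by (simp add: T_def)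
    have "continuous_map (subtopology ?Z T) F (\<lambda>e. fst (\<theta> (e i)))" if "i < r" for i
      using continuous_map_compose[OF \<theta>T[OF that] continuous_map_fst] by (simp add: o_def)
    then show "continuous_map (subtopology ?Z T) (power_space r F) (\<lambda>e. \<lambda>i\<in>{..<r}. fst (\<theta> (e i)))"
      unfolding power_space_def continuous_map_componentwise by auto
    show "continuous_map (subtopology ?Z T) P (\<lambda>e. snd (\<theta> (e 0)))"
      using continuous_map_compose[OF \<theta>T[OF r] continuous_map_snd] by (simp add: o_def)
    fix e assume e: "e \<in> T"
    show "tuple_cls r (\<lambda>i\<in>{..<r}. fst (\<theta> (e i))) (snd (\<theta> (e 0))) = e"
    proof
      fix i
      show "tuple_cls r (\<lambda>i\<in>{..<r}. fst (\<theta> (e i))) (snd (\<theta> (e 0))) i = e i"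
      proof (cases "i < r")
        case True
        then show ?thesis using T[OF e True] cls\<theta>[of "e i"] by (simp add: tuple_cls_def)
      next
        case False
        moreover have "e \<in> extensional {..<r}" using e Z(3)[OF _ r] by (simp add: T_def)
        ultimately show ?thesis by (simp add: tuple_cls_def extensional_def)
      qed
    qed
  qed
qed

lemma equivariant_section_induces_section:
  assumes MF: "mtopology_of MF = path_space F"
    and ME: "mtopology_of ME = vertical_path_space E assoc_proj"
    and r: "r \<ge> 2"
    and s: "is_section_of_measures MF (power_space r F) (path_eval r) k s"
    and equi: "\<And>g f. g \<in> carrier G \<Longrightarrow> f \<in> topspace (power_space r F) \<Longrightarrow>
      s (power_action r \<phi> g f) = map_pmf (path_action \<phi> g) (s f)"
  obtains \<sigma> where "is_section_of_measures ME (fibre_power r E assoc_proj) (path_eval r) k \<sigma>"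
proof -
  let ?Z = "fibre_power r E assoc_proj"
  have r0: "r > 0" using r by simp
  have s_cont: "continuous_map (power_space r F) (fin_measure_space MF k) s"
    and s_fib: "\<And>f. f \<in> topspace (power_space r F) \<Longrightarrow> set_pmf (s f) \<subseteq> {\<gamma> \<in> mspace MF. path_eval r \<gamma> = f}"
    using s by (auto simp: is_section_of_measures_iff)
  have mspace_MF: "mspace MF = paths F"
    using MF by (metis topspace_mtopology_of topspace_path_space)
  define push where "push f x = map_pmf (\<lambda>\<gamma>. path_cls \<gamma> x) (s f)" for f x
  define lifts where "lifts e p \<longleftrightarrow> fst p \<in> topspace (power_space r F) \<and> snd p \<in> topspace P \<and>
    tuple_cls r (fst p) (snd p) = e" for e p
  define \<sigma> where "\<sigma> e = (let p = SOME p. lifts e p in push (fst p) (snd p))" for e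
  have push_eq: "push f x = push f' x'" if 1: "lifts e (f, x)" and 2: "lifts e (f', x')" for e f x f' x'
  proof -
    have f: "f \<in> topspace (power_space r F)" and x: "x \<in> topspace P" using 1 by (auto simp: lifts_def)
    obtain g where g: "g \<in> carrier G" "x' = \<psi> g x" "f' = power_action r \<phi> g f"
      using 1 2 tuple_cls_eq_imp[OF r0, of f f' x x'] by (auto simp: lifts_def)
    have "push f' x' = map_pmf (\<lambda>\<gamma>. path_cls (path_action \<phi> g \<gamma>) (\<psi> g x)) (s f)"
      using equi[OF g(1) f] g by (simp add: push_def map_pmf_comp)
    also have "\<dots> = push f x"
      unfolding push_def using path_cls_action[OF g(1) _ x] s_fib[OF f] mspace_MF
      by (intro map_pmf_cong) auto
    finally show ?thesis by simp
  qed
  have \<sigma>: "\<sigma> e = push f x" if "lifts e (f, x)" for e f x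
    using push_eq[OF that, of "fst (SOME p. lifts e p)" "snd (SOME p. lifts e p)"] someI[of "lifts e", OF that]
    by (simp add: \<sigma>_def Let_def)
  have lifts_ex: "\<exists>T \<tau> \<xi>. openin ?Z T \<and> e \<in> T \<and>
    continuous_map (subtopology ?Z T) (power_space r F) \<tau> \<and> continuous_map (subtopology ?Z T) P \<xi> \<and>
    (\<forall>e\<in>T. lifts e (\<tau> e, \<xi> e))" if e: "e \<in> topspace ?Z" for e
  proof -
    obtain T \<tau> \<xi> where T: "openin ?Z T" "e \<in> T" "continuous_map (subtopology ?Z T) (power_space r F) \<tau>"
      "continuous_map (subtopology ?Z T) P \<xi>" "\<And>e. e \<in> T \<Longrightarrow> tuple_cls r (\<tau> e) (\<xi> e) = e"
      using fibre_power_local_lift[OF r0 e] by metis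
    moreover have "\<tau> e \<in> topspace (power_space r F)" "\<xi> e \<in> topspace P" if "e \<in> T" for e
      using T(3,4) that openin_subset[OF T(1)] by (auto simp: continuous_map_def)
    ultimately show ?thesis
      unfolding lifts_def by (intro exI[of _ T] exI[of _ \<tau>] exI[of _ \<xi>]) auto
  qed
  have "continuous_map ?Z (fin_measure_space ME k) \<sigma>"
  proof -
    have "\<exists>T. openin ?Z T \<and> e \<in> T \<and> continuous_map (subtopology ?Z T) (fin_measure_space ME k) \<sigma>"
      if "e \<in> topspace ?Z" for e
    proof -
      obtain T \<tau> \<xi> where T: "openin ?Z T" "e \<in> T" and \<tau>: "continuous_map (subtopology ?Z T) (power_space r F) \<tau>"
        and \<xi>: "continuous_map (subtopology ?Z T) P \<xi>" and lift: "\<forall>e\<in>T. lifts e (\<tau> e, \<xi> e)"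
        using lifts_ex[OF \<open>e \<in> topspace ?Z\<close>] by blast
      have "continuous_map (subtopology ?Z T) (fin_measure_space MF k) (\<lambda>e. s (\<tau> e))"
        using continuous_map_compose[OF \<tau> s_cont] by (simp add: o_def)
      then have "continuous_map (subtopology ?Z T) (fin_measure_space ME k) (\<lambda>e. push (\<tau> e) (\<xi> e))"
        unfolding push_def using \<xi> continuous_map_path_cls[folded MF ME]
        by (rule continuous_map_pushforward)
      then have "continuous_map (subtopology ?Z T) (fin_measure_space ME k) \<sigma>"
        by (rule continuous_map_eq) (use lift \<sigma> in auto)
      then show ?thesis using T by blast
    qed
    then obtain T where T: "\<And>e. e \<in> topspace ?Z \<Longrightarrow> openin ?Z (T e) \<and> e \<in> T e \<and>
      continuous_map (subtopology ?Z (T e)) (fin_measure_space ME k) \<sigma>" by metis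
    show ?thesis
      by (rule pasting_lemma[of "topspace ?Z" ?Z T _ "\<lambda>_. \<sigma>"]) (use T in auto)
  qed
  moreover have "set_pmf (\<sigma> e) \<subseteq> {\<gamma> \<in> mspace ME. path_eval r \<gamma> = e}" if e: "e \<in> topspace ?Z" for e
  proof -
    obtain f x where fx: "lifts e (f, x)" using lifts_ex[OF e] by blast
    then have f: "f \<in> topspace (power_space r F)" and x: "x \<in> topspace P" and "tuple_cls r f x = e"
      by (auto simp: lifts_def)
    have "path_cls \<gamma> x \<in> mspace ME" if "\<gamma> \<in> mspace MF" for \<gamma>
      using continuous_map_image_subset_topspace[OF continuous_map_path_cls[folded MF ME]] that x
      by force
    then show ?thesis
      using s_fib[OF f] path_eval_path_cls[OF r] \<open>tuple_cls r f x = e\<close>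
      by (auto simp: \<sigma>[OF fx] push_def)
  qed
  ultimately have "is_section_of_measures ME ?Z (path_eval r) k \<sigma>"
    by (simp add: is_section_of_measures_iff)
  then show thesis by (rule that)
qed

lemma parametrized_dTC_le_equivariant_dTC:
  assumes MF: "mtopology_of MF = path_space F"
    and ME: "mtopology_of ME = vertical_path_space E assoc_proj"
    and r: "r \<ge> 2"
  shows "parametrized_dTC r ME E assoc_proj \<le> equivariant_dTC r G MF F \<phi>"
  unfolding parametrized_dTC_def equivariant_dTC_def dsecat_def equivariant_dsecat_def
proof (rule Inf_superset_mono, clarify)
  fix n s
  assume "is_section_of_measures MF (power_space r F) (path_eval r) (n + 1) s"
    "\<forall>g\<in>carrier G. \<forall>b\<in>topspace (power_space r F).
      s (power_action r \<phi> g b) = map_pmf (path_action \<phi> g) (s b)"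
  then obtain \<sigma> where "is_section_of_measures ME (fibre_power r E assoc_proj) (path_eval r) (n + 1) \<sigma>"
    using equivariant_section_induces_section[OF MF ME r] by metis
  then show "\<exists>m. enat n = enat m \<and>
      (\<exists>s. is_section_of_measures ME (fibre_power r E assoc_proj) (path_eval r) (m + 1) s)"
    by blast
qed

end

lemma enat_le_square: "(n::enat) \<le> (n + 1)\<^sup>2 - 1"
proof (cases n)
  case (enat m)
  then show ?thesis by (simp add: one_enat_def power2_eq_square)
qed (simp add: power2_eq_square one_enat_def)

theorem theorem8p1:
  fixes G :: "('g, 'z) monoid_scheme" and TG :: "'g topology"
    and F :: "'f topology" and \<phi> :: "'g \<Rightarrow> 'f \<Rightarrow> 'f"
    and P :: "'p topology" and \<psi> :: "'g \<Rightarrow> 'p \<Rightarrow> 'p"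
    and B :: "'b topology" and q :: "'p \<Rightarrow> 'b"
    and MF :: "(real \<Rightarrow> 'f) metric" and ME :: "(real \<Rightarrow> ('f \<times> 'p) set) metric"
    and r :: nat
  assumes "topological_group G TG"
    and "G_space G TG F \<phi>"
    and "principal_bundle G TG P \<psi> B q"
    and "path_connected_space F" and "path_connected_space B"
    and "mtopology_of MF = path_space F"
    and "mtopology_of ME = vertical_path_space (assoc_space G F \<phi> P \<psi>) assoc_proj"
    and "r \<ge> 2"
  shows "parametrized_dTC r ME (assoc_space G F \<phi> P \<psi>) assoc_proj
    \<le> (equivariant_dTC r G MF F \<phi> + 1)\<^sup>2 - 1"
proof -
  interpret associated_bundle G TG F \<phi> P \<psi> B q
    using assms(2,3) by unfold_locales
  show ?thesis
    using parametrized_dTC_le_equivariant_dTC[OF assms(6,7,8)] enat_le_square by (rule order_trans)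
qed

end
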